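(* Let $\mu_1,\dots,\mu_d$ be probability measures on $\mathbb{R}$ with finite moments of any order, with classical Favard sequences $(\alpha_{k,n},\beta_{k,n},P_{k,n})_{n\in\mathbb{N}}$, $1\le k\le d$, and let $\mu=\mu_1\otimes\cdots\otimes\mu_d$. Let $(\Omega_n)_n$, $(\alpha_{\cdot|n})_n$ be the Jacobi sequences of $\mu$ with respect to the canonical basis of $\mathbb{C}^d$. Then for every $n\ge 1$ and all $\bar i_n=\mathrm{cl}(i_1,\dots,i_n)$, $\bar j_n=\mathrm{cl}(j_1,\dots,j_n)$ in $\mathcal{A}_n$, in the basis $\mathcal{B}=(e_{\bar j_n})_{\bar j_n\in\mathcal{A}_n}$ of $(\mathbb{C}^d)^{\hat\otimes n}$ one has $$\Omega_{n,\bar i_n\bar j_n}=\delta_{\bar i_n\bar j_n}\prod_{r=1}^{d}\Big(\prod_{k=0}^{m_r-1}\beta_{r,k}\Big)^2,$$ and, for every $1\le l\le d$, $$\alpha_{e_l|n}\,e_{\bar i_n}=\alpha_{l,m_l}\,e_{\bar i_n},$$ where $m_l=\sharp\{k\in\{1,\dots,n\}: i_k=l\}$ for $1\le l\le d$, with the convention $\prod_{k=0}^{-1}\beta_{l,k}=1$.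
   Context: Let $d\in\mathbb{N}$, $d\ge1$. Classical Favard sequences: for each $1\le k\le d$, $(\beta_{k,n})_{n\in\mathbb{N}}$ is a sequence of positive reals, $(\alpha_{k,n})_{n\in\mathbb{N}}$ a sequence of reals, and $(P_{k,n})_{n\in\mathbb{N}}$ a family of polynomials in one variable, orthonormal for the scalar product induced by $\mu_k$, with $$XP_{k,n}=\beta_{k,n}P_{k,n+1}+\alpha_{k,n}P_{k,n}+\beta_{k,n-1}P_{k,n-1},\qquad P_{k,-1}=0,\ P_{k,0}=1 .$$ Polynomial algebra: $\mathcal{P}=\mathbb{C}[X_1,\dots,X_d]$ is the complex polynomial $*$-algebra with self-adjoint commuting indeterminates $X_j$. The measure $\mu$ on $\mathbb{R}^d$ induces the state $\varphi(b)=\int_{\mathbb{R}^d}b\,d\mu$ on $\mathcal{P}$ and the scalar product $\langle a,b\rangle=\varphi(a^*b)$. $\mathcal{P}_{n]}$ is the span of monomials of degree $\le n$ ($\mathcal{P}_{-1]}=\{0\}$), $\mathcal{P}_n$ is the orthogonal complement of $\mathcal{P}_{n-1]}$ in $\mathcal{P}_{n]}$, so $\mathcal{P}=\bigoplus_n\mathcal{P}_n$ (algebraic orthogonal direct sum), and $P_n$ is the orthogonal projector of $\mathcal{P}$ onto $\mathcal{P}_n$ (single index; not to be confused with the polynomials $P_{k,n}$). Put $\Phi=1_{\mathcal{P}}$, $a^+_{j|n}:=P_{n+1}X_jP_n|_{\mathcal{P}_n}:\mathcal{P}_n\to\mathcal{P}_{n+1}$, $a^0_{j|n}:=P_nX_jP_n|_{\mathcal{P}_n}:\mathcal{P}_n\to\mathcal{P}_n$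 (where $X_j$ acts by multiplication), and let $a^+_j=\sum_na^+_{j|n}$ be the linear operator on $\mathcal{P}$ whose restriction to $\mathcal{P}_n$ is $a^+_{j|n}$. The operators $a_1^+,\dots,a_d^+$ commute. Tensor spaces: $V=\mathbb{C}^d$ with the canonical scalar product and canonical basis $(e_j)_{1\le j\le d}$. $V^{\hat\otimes n}$ is the $n$-th symmetric tensor power, $\hat\otimes$ the symmetrized tensor product, so $v_1\hat\otimes\cdots\hat\otimes v_n=\frac1{n!}\sum_{\pi\in S_n}v_{\pi(1)}\otimes\cdots\otimes v_{\pi(n)}$, with the scalar product determined by $\langle u^{\otimes n},v^{\otimes n}\rangle_{V^{\hat\otimes n}}=\langle u,v\rangle_V^n$. For $v=\sum_jv_je_j$ put $a^+_v=\sum_jv_ja^+_j$. The map $U_n:V^{\hat\otimes n}\to\mathcal{P}_n$ is the vector space isomorphism determined by $U_n(v_n\hat\otimes\cdots\hat\otimes v_1)=a^+_{v_n}\cdots a^+_{v_1}\Phi$. Jacobi sequences of $\mu$: $\Omega_n$ is the linear operator on $V^{\hat\otimes n}$ with $\langle\xi,\Omega_n\eta\rangle_{V^{\hat\otimes n}}=\langle U_n\xi,U_n\eta\rangle$ for all $\xi,\eta\in V^{\hat\otimes n}$, and $\alpha_{e_l|n}:=U_n^{-1}a^0_{l|n}U_n$, a linear operator on $V^{\hat\otimes n}$, for $1\le l\le d$. Index set and basis: $\mathrm{cl}(i_1,\dots,i_n)$ is the class of $(i_1,\dots,i_n)\in\{1,\dots,d\}^n$ under the equivalence relation identifying two tuples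 when one is obtained from the other by a permutation of the entries; $\mathcal{A}_n$ is the set of all these classes. For $\bar j_n=\mathrm{cl}(j_1,\dots,j_n)$ put $e_{\bar j_n}:=e_{j_1}\hat\otimes\cdots\hat\otimes e_{j_n}$; then $\mathcal{B}=(e_{\bar j_n})_{\bar j_n\in\mathcal{A}_n}$ is a basis of $(\mathbb{C}^d)^{\hat\otimes n}$. The entries of $\Omega_n$ in this basis are $\Omega_{n,\bar i_n\bar j_n}:=\langle e_{\bar i_n},\Omega_ne_{\bar j_n}\rangle_{(\mathbb{C}^d)^{\hat\otimes n}}$. *)

theory Defs
  imports
    "HOL-Analysis.Analysis"
    "HOL-Probability.Probability_Measure"
    "HOL-Library.Poly_Mapping"
    "HOL-Combinatorics.Permutations"
    "HOL-Computational_Algebra.Polynomial"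
begin

section \<open>Free complex vector spaces\<close>

definition scale :: "complex \<Rightarrow> ('a \<Rightarrow>\<^sub>0 complex) \<Rightarrow> ('a \<Rightarrow>\<^sub>0 complex)" where
  "scale c p = Poly_Mapping.map ((*) c) p"

lemma lookup_scale [simp]: "Poly_Mapping.lookup (scale c p) x = c * Poly_Mapping.lookup p x"
  by (simp add: scale_def Poly_Mapping.map.rep_eq when_def)

interpretation free_vs: vector_space scale
  by unfold_locales (auto intro!: poly_mapping_eqI simp: lookup_add algebra_simps)

definition linear_on :: "('a \<Rightarrow>\<^sub>0 complex) set \<Rightarrow> (('a \<Rightarrow>\<^sub>0 complex) \<Rightarrow> ('b \<Rightarrow>\<^sub>0 complex)) \<Rightarrow> bool" where
  "linear_on S f \<longleftrightarrow>
     (\<forall>x\<in>S. \<forall>y\<in>S. f (x + y) = f x + f y) \<and> (\<forall>c. \<forall>x\<in>S. f (scale c x) = scale c (f x))"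


section \<open>Classical Favard sequences\<close>

text \<open>The case distinction at \<open>n = 0\<close> encodes the convention that the polynomial of index
  \<open>-1\<close> is zero.\<close>

definition favard_sequences ::
    "real measure \<Rightarrow> (nat \<Rightarrow> real) \<Rightarrow> (nat \<Rightarrow> real) \<Rightarrow> (nat \<Rightarrow> complex poly) \<Rightarrow> bool" where
  "favard_sequences \<mu> \<alpha> \<beta> P \<longleftrightarrow>
     (\<forall>n. 0 < \<beta> n) \<and>
     (\<forall>m n. (LINT x|\<mu>. cnj (poly (P m) (of_real x)) * poly (P n) (of_real x)) = of_bool (m = n)) \<and>
     P 0 = 1 \<and>
     (\<forall>n. [:0, 1:] * P n =
            smult (of_real (\<beta> n)) (P (Suc n)) + smult (of_real (\<alpha> n)) (P n) +
            (if n = 0 then 0 else smult (of_real (\<beta> (n - 1))) (P (n - 1))))"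


section \<open>The polynomial algebra and its orthogonal gradation\<close>

text \<open>The indeterminates are indexed by a finite type \<open>'d\<close>, which plays the role of
  \<open>{1,\<dots>,d}\<close>. A monomial is its exponent vector, of type \<open>'d \<Rightarrow>\<^sub>0 nat\<close>, and multiplication of
  polynomials is convolution of finitely supported functions.\<close>

type_synonym 'd mpoly = "('d \<Rightarrow>\<^sub>0 nat) \<Rightarrow>\<^sub>0 complex"

definition X :: "'d \<Rightarrow> 'd mpoly" where
  "X j = Poly_Mapping.single (Poly_Mapping.single j 1) 1"

definition star :: "'d mpoly \<Rightarrow> 'd mpoly" where
  "star p = Poly_Mapping.map cnj p"

definition eval_poly :: "'d::finite mpoly \<Rightarrow> ('d \<Rightarrow> real) \<Rightarrow> complex" where
  "eval_poly p x =
     (\<Sum>m\<in>Poly_Mapping.keys p.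
        Poly_Mapping.lookup p m * (\<Prod>j\<in>UNIV. of_real (x j) ^ Poly_Mapping.lookup m j))"

definition state :: "('d::finite \<Rightarrow> real) measure \<Rightarrow> 'd mpoly \<Rightarrow> complex" where
  "state \<mu> p = (LINT x|\<mu>. eval_poly p x)"

definition pinner :: "('d::finite \<Rightarrow> real) measure \<Rightarrow> 'd mpoly \<Rightarrow> 'd mpoly \<Rightarrow> complex" where
  "pinner \<mu> p q = state \<mu> (star p * q)"

definition polys_le :: "nat \<Rightarrow> 'd::finite mpoly set" where
  "polys_le n =
     free_vs.span {Poly_Mapping.single m 1 |m. (\<Sum>j\<in>UNIV. Poly_Mapping.lookup m j) \<le> n}"

text \<open>For \<open>n = 0\<close> the orthogonality condition is void, since the space of index \<open>-1\<close> is
  \<open>{0}\<close>.\<close>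

definition graded_part :: "('d::finite \<Rightarrow> real) measure \<Rightarrow> nat \<Rightarrow> 'd mpoly set" where
  "graded_part \<mu> n =
     {p \<in> polys_le n. \<forall>q \<in> (if n = 0 then {0} else polys_le (n - 1)). pinner \<mu> q p = 0}"

definition proj :: "('d::finite \<Rightarrow> real) measure \<Rightarrow> nat \<Rightarrow> 'd mpoly \<Rightarrow> 'd mpoly" where
  "proj \<mu> n p =
     (THE q. q \<in> graded_part \<mu> n \<and> (\<forall>r \<in> graded_part \<mu> n. pinner \<mu> r (p - q) = 0))"

definition creation_at :: "('d::finite \<Rightarrow> real) measure \<Rightarrow> nat \<Rightarrow> 'd \<Rightarrow> 'd mpoly \<Rightarrow> 'd mpoly" where
  "creation_at \<mu> n j p = proj \<mu> (Suc n) (X j * proj \<mu> n p)"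

definition preservation_at :: "('d::finite \<Rightarrow> real) measure \<Rightarrow> nat \<Rightarrow> 'd \<Rightarrow> 'd mpoly \<Rightarrow> 'd mpoly" where
  "preservation_at \<mu> n j p = proj \<mu> n (X j * proj \<mu> n p)"

text \<open>On a polynomial \<open>p\<close> only the terms with \<open>n\<close> up to the degree of \<open>p\<close> contribute, so the
  sum over all \<open>n\<close> is finite.\<close>

definition creation :: "('d::finite \<Rightarrow> real) measure \<Rightarrow> 'd \<Rightarrow> 'd mpoly \<Rightarrow> 'd mpoly" where
  "creation \<mu> j p = Sum_any (\<lambda>n. creation_at \<mu> n j p)"

definition creation_vec :: "('d::finite \<Rightarrow> real) measure \<Rightarrow> complex ^ 'd \<Rightarrow> 'd mpoly \<Rightarrow> 'd mpoly" where
  "creation_vec \<mu> v p = (\<Sum>j\<in>UNIV. scale (v $ j) (creation \<mu> j p))"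


section \<open>Symmetric tensors over \<open>complex ^ 'd\<close>\<close>

text \<open>A tensor is given by its coordinates in the basis of elementary tensors of canonical basis
  vectors, indexed by words over \<open>'d\<close>; tensors of order \<open>n\<close> live on words of length \<open>n\<close>.\<close>

type_synonym 'd tensor = "'d list \<Rightarrow>\<^sub>0 complex"

definition tensor_prod :: "(complex ^ 'd) list \<Rightarrow> 'd::finite tensor" where
  "tensor_prod vs =
     (\<Sum>w | length w = length vs. Poly_Mapping.single w (\<Prod>k<length vs. (vs ! k) $ (w ! k)))"

definition sym_prod :: "(complex ^ 'd) list \<Rightarrow> 'd::finite tensor" where
  "sym_prod vs =
     scale (1 / fact (length vs))
       (\<Sum>\<pi> | \<pi> permutes {..<length vs}. tensor_prod (permute_list \<pi> vs))"

definition sym_tensors :: "nat \<Rightarrow> 'd tensor set" where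
  "sym_tensors n =
     {\<xi>. Poly_Mapping.keys \<xi> \<subseteq> {w. length w = n} \<and>
         (\<forall>\<pi> w. \<pi> permutes {..<n} \<longrightarrow> length w = n \<longrightarrow>
            Poly_Mapping.lookup \<xi> (permute_list \<pi> w) = Poly_Mapping.lookup \<xi> w)}"

definition tinner :: "'d tensor \<Rightarrow> 'd tensor \<Rightarrow> complex" where
  "tinner \<xi> \<eta> =
     (\<Sum>w\<in>Poly_Mapping.keys \<xi>. cnj (Poly_Mapping.lookup \<xi> w) * Poly_Mapping.lookup \<eta> w)"


lemma finite_words: "finite {w::'d::finite list. length w = n}"
  using finite_lists_length_eq[of "UNIV :: 'd set" n] by simp

lemma lookup_tensor_prod:
  "Poly_Mapping.lookup (tensor_prod vs) w =
     (if length w = length vs then \<Prod>k<length vs. (vs ! k) $ (w ! k) else 0)"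
  by (simp add: tensor_prod_def lookup_sum lookup_single when_def sum.delta[OF finite_words])

lemma lookup_tensor_prod_permute:
  assumes "\<sigma> permutes {..<length vs}" "length w = length vs"
  shows "Poly_Mapping.lookup (tensor_prod (permute_list \<sigma> vs)) (permute_list \<sigma> w) =
           Poly_Mapping.lookup (tensor_prod vs) w"
proof -
  have "(\<Prod>k<length vs. (vs ! k) $ (w ! k)) = (\<Prod>k<length vs. (vs ! \<sigma> k) $ (w ! \<sigma> k))"
    using prod.permute[OF assms(1), of "\<lambda>k. (vs ! k) $ (w ! k)"] by (simp add: o_def)
  with assms show ?thesis
    by (auto simp: lookup_tensor_prod permute_list_nth intro!: prod.cong)
qed

lemma sym_prod_permute:
  assumes "\<sigma> permutes {..<length vs}"
  shows "sym_prod (permute_list \<sigma> vs) = sym_prod vs"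
proof -
  let ?S = "{\<pi>. \<pi> permutes {..<length vs}}"
  have "(\<Sum>\<pi>\<in>?S. tensor_prod (permute_list \<pi> vs)) =
          (\<Sum>\<pi>\<in>?S. tensor_prod (permute_list (\<sigma> \<circ> \<pi>) vs))"
    by (rule setum_permutations_compose_left[OF assms])
  also have "\<dots> = (\<Sum>\<pi>\<in>?S. tensor_prod (permute_list \<pi> (permute_list \<sigma> vs)))"
    by (rule sum.cong) (auto simp: permute_list_compose)
  finally show ?thesis by (simp add: sym_prod_def)
qed

lemma sym_prod_in_sym_tensors: "sym_prod vs \<in> sym_tensors (length vs)"
proof -
  let ?S = "{\<pi>. \<pi> permutes {..<length vs}}"
  let ?T = "\<lambda>\<pi>. Poly_Mapping.lookup (tensor_prod (permute_list \<pi> vs))"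
  have lookup_sym: "Poly_Mapping.lookup (sym_prod vs) w = 1 / fact (length vs) * (\<Sum>\<pi>\<in>?S. ?T \<pi> w)" for w
    by (simp add: sym_prod_def lookup_sum)
  have "Poly_Mapping.lookup (sym_prod vs) (permute_list \<sigma> w) = Poly_Mapping.lookup (sym_prod vs) w"
    if \<sigma>: "\<sigma> permutes {..<length vs}" and w: "length w = length vs" for \<sigma> w
  proof -
    have "(\<Sum>\<pi>\<in>?S. ?T \<pi> (permute_list \<sigma> w)) = (\<Sum>\<pi>\<in>?S. ?T (\<pi> \<circ> \<sigma>) (permute_list \<sigma> w))"
      by (rule sum_permutations_compose_right[OF \<sigma>])
    also have "\<dots> = (\<Sum>\<pi>\<in>?S. ?T \<pi> w)"
      using \<sigma> w by (intro sum.cong) (auto simp: permute_list_compose lookup_tensor_prod_permute)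
    finally show ?thesis by (simp add: lookup_sym)
  qed
  moreover have "Poly_Mapping.keys (sym_prod vs) \<subseteq> {w. length w = length vs}"
  proof
    fix w assume "w \<in> Poly_Mapping.keys (sym_prod vs)"
    then have "(\<Sum>\<pi>\<in>?S. ?T \<pi> w) \<noteq> 0"
      by (simp add: in_keys_iff lookup_sym)
    then obtain \<pi> where "?T \<pi> w \<noteq> 0"
      by (rule sum.not_neutral_contains_not_neutral)
    then show "w \<in> {w. length w = length vs}"
      by (simp add: lookup_tensor_prod split: if_splits)
  qed
  ultimately show ?thesis by (simp add: sym_tensors_def)
qed

lemma sum_words_prod:
  fixes f :: "'d::finite \<Rightarrow> 'a::comm_semiring_1"
  shows "(\<Sum>w | length w = n. \<Prod>k<n. f (w ! k)) = (\<Sum>j\<in>UNIV. f j) ^ n"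
proof (induction n)
  case (Suc n)
  have "(\<Sum>w | length w = Suc n. \<Prod>k<Suc n. f (w ! k)) =
          (\<Sum>(j, w) \<in> UNIV \<times> {w. length w = n}. f j * (\<Prod>k<n. f (w ! k)))"
    by (rule sum.reindex_bij_witness[where i = "\<lambda>(j, w). j # w" and j = "\<lambda>w. (hd w, tl w)"])
       (auto simp: length_Suc_conv prod.lessThan_Suc_shift simp del: prod.lessThan_Suc)
  also have "\<dots> = (\<Sum>j\<in>UNIV. f j) * (\<Sum>w | length w = n. \<Prod>k<n. f (w ! k))"
    by (simp add: sum_product sum.cartesian_product)
  finally show ?case using Suc by simp
qed simp

text \<open>The scalar product on symmetric tensors is the one determined by its values on powers.\<close>

lemma tinner_power:
  "tinner (sym_prod (replicate n u)) (sym_prod (replicate n v)) =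
     (\<Sum>j\<in>UNIV. cnj (u $ j) * v $ j) ^ n"
proof -
  have sym: "sym_prod (replicate n u) = tensor_prod (replicate n u)" for u :: "complex ^ 'd"
  proof -
    have "permute_list \<pi> (replicate n u) = replicate n u" if "\<pi> permutes {..<n}" for \<pi>
      proof (intro nth_equalityI)
        fix k assume "k < length (permute_list \<pi> (replicate n u))"
        then have "k < n" by simp
        moreover from this have "\<pi> k < n" using permutes_in_image[OF that, of k] by simp
        ultimately show "permute_list \<pi> (replicate n u) ! k = replicate n u ! k"
          using that by (simp add: permute_list_nth)
      qed simp
    then have "(\<Sum>\<pi> | \<pi> permutes {..<n}. tensor_prod (permute_list \<pi> (replicate n u))) =
                 (\<Sum>\<pi> | \<pi> permutes {..<n}. tensor_prod (replicate n u))"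
      by (intro sum.cong) auto
    then show ?thesis
      by (intro poly_mapping_eqI) (simp add: sym_prod_def lookup_sum card_permutations)
  qed
  let ?u = "tensor_prod (replicate n u)" and ?v = "tensor_prod (replicate n v)"
  have "tinner ?u ?v = (\<Sum>w | length w = n. cnj (Poly_Mapping.lookup ?u w) * Poly_Mapping.lookup ?v w)"
    unfolding tinner_def
    by (rule sum.mono_neutral_left)
       (auto simp: finite_words in_keys_iff lookup_tensor_prod split: if_splits)
  also have "\<dots> = (\<Sum>w | length w = n. \<Prod>k<n. cnj (u $ (w ! k)) * v $ (w ! k))"
    by (intro sum.cong) (auto simp: lookup_tensor_prod prod.distrib)
  also have "\<dots> = (\<Sum>j\<in>UNIV. cnj (u $ j) * v $ j) ^ n"
    by (rule sum_words_prod)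
  finally show ?thesis by (simp add: sym)
qed


section \<open>Jacobi sequences of a measure\<close>

definition U_map :: "('d::finite \<Rightarrow> real) measure \<Rightarrow> nat \<Rightarrow> 'd tensor \<Rightarrow> 'd mpoly" where
  "U_map \<mu> n =
     (THE U. U \<in> extensional (sym_tensors n) \<and> linear_on (sym_tensors n) U \<and>
             bij_betw U (sym_tensors n) (graded_part \<mu> n) \<and>
             (\<forall>vs. length vs = n \<longrightarrow> U (sym_prod vs) = foldr (creation_vec \<mu>) vs 1))"

definition Omega :: "('d::finite \<Rightarrow> real) measure \<Rightarrow> nat \<Rightarrow> 'd tensor \<Rightarrow> 'd tensor" where
  "Omega \<mu> n =
     (THE \<Omega>. \<Omega> \<in> sym_tensors n \<rightarrow>\<^sub>E sym_tensors n \<and> linear_on (sym_tensors n) \<Omega> \<and>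
             (\<forall>\<xi>\<in>sym_tensors n. \<forall>\<eta>\<in>sym_tensors n.
                tinner \<xi> (\<Omega> \<eta>) = pinner \<mu> (U_map \<mu> n \<xi>) (U_map \<mu> n \<eta>)))"

definition alpha_op :: "('d::finite \<Rightarrow> real) measure \<Rightarrow> 'd \<Rightarrow> nat \<Rightarrow> 'd tensor \<Rightarrow> 'd tensor" where
  "alpha_op \<mu> l n \<xi> =
     inv_into (sym_tensors n) (U_map \<mu> n) (preservation_at \<mu> n l (U_map \<mu> n \<xi>))"


section \<open>Classes of tuples and the associated basis\<close>

definition perm_rel :: "nat \<Rightarrow> ('d list \<times> 'd list) set" where
  "perm_rel n =
     {(xs, ys). length xs = n \<and> (\<exists>\<pi>. \<pi> permutes {..<n} \<and> ys = permute_list \<pi> xs)}"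

definition cl :: "'d list \<Rightarrow> 'd list set" where
  "cl xs = perm_rel (length xs) `` {xs}"

definition e_basis :: "'d list set \<Rightarrow> 'd::finite tensor" where
  "e_basis C = sym_prod (map (\<lambda>j. axis j 1) (SOME xs. xs \<in> C))"

lemma e_basis_cl: "e_basis (cl xs) = sym_prod (map (\<lambda>j. axis j 1) xs)"
proof -
  have "xs \<in> cl xs"
    by (auto simp: cl_def perm_rel_def intro!: exI[of _ id] permutes_id)
  then have "(SOME ys. ys \<in> cl xs) \<in> cl xs"
    by (rule someI)
  then obtain \<pi> where "\<pi> permutes {..<length xs}" "(SOME ys. ys \<in> cl xs) = permute_list \<pi> xs"
    by (auto simp: cl_def perm_rel_def)
  then show ?thesis
    by (simp add: e_basis_def sym_prod_permute flip: permute_list_map)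
qed

definition Omega_entry ::
    "('d::finite \<Rightarrow> real) measure \<Rightarrow> nat \<Rightarrow> 'd list set \<Rightarrow> 'd list set \<Rightarrow> complex" where
  "Omega_entry \<mu> n C D = tinner (e_basis C) (Omega \<mu> n (e_basis D))"

end

theory Submission
  imports Defs
begin

text \<open>For a single measure, \<open>\<pi> n = (\<Prod>k<n. \<beta> k) P n\<close> is the monic orthogonal polynomial of
  degree \<open>n\<close>; its squared norm is \<open>(\<Prod>k<n. \<beta> k)\<^sup>2\<close>, and
  \<open>X \<pi> n = \<pi> (n + 1) + \<alpha> n \<pi> n + (\<beta> (n - 1))\<^sup>2 \<pi> (n - 1)\<close>. For a product measure take the products
  \<open>Q M\<close> of these polynomials, one factor for each coordinate, of degree \<open>count M r\<close> in \<open>X r\<close>.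
  By Fubini they are orthogonal with product norms (\<open>pinner_Q\<close>), and multiplication by \<open>X j\<close> only
  affects the \<open>j\<close>-th factor, so the three-term recursion survives (\<open>X_mult_Q\<close>).

  The recursion is triangular with respect to monomials, whence the \<open>Q M\<close> with
  \<open>size M \<le> n\<close> span the polynomials of degree at most \<open>n\<close>; being orthogonal, those with
  \<open>size M = n\<close> span the homogeneous component of the gradation (\<open>graded_part_eq_span_Q\<close>). The
  three terms of \<open>X j * Q M\<close> thus lie in three consecutive components: the first is the creation
  operator, which adds \<open>j\<close> to \<open>M\<close>, and the second is the preservation operator, for which \<open>Q M\<close>
  is an eigenvector with eigenvalue \<open>\<alpha> j (count M j)\<close>.

  Hence \<open>U\<close> maps the basis tensor of the class of a word \<open>w\<close> to \<open>Q (mset w)\<close>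
  (\<open>U_map_e_basis\<close>). Both assertions are then read off from the orthogonality relations of the
  \<open>Q M\<close> and the eigenvalue of the preservation operator. Since \<open>U\<close> and \<open>\<Omega>\<close> are given by definite
  descriptions, one must also know that they exist and are unique. On tensors written in
  coordinates both have explicit formulas; uniqueness holds because symmetric products of basis
  vectors span the symmetric tensors, respectively because the scalar product is
  definite.\<close>

section \<open>Evaluation of polynomials\<close>

text \<open>The sum may run over any finite set of monomials containing the support; taking a common
  one makes evaluation visibly additive.\<close>

lemma eval_poly_superset:
  assumes "finite S" "Poly_Mapping.keys p \<subseteq> S"
  shows "eval_poly p x =
    (\<Sum>m\<in>S. Poly_Mapping.lookup p m * (\<Prod>j\<in>UNIV. of_real (x j) ^ Poly_Mapping.lookup m j))"
  unfolding eval_poly_def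
  by (rule sum.mono_neutral_left) (use assms in \<open>auto simp: in_keys_iff\<close>)

lemma eval_poly_single:
  "eval_poly (Poly_Mapping.single m c) x = c * (\<Prod>j\<in>UNIV. of_real (x j) ^ Poly_Mapping.lookup m j)"
  by (subst eval_poly_superset[of "{m}"]) (auto simp: lookup_single)

lemma eval_poly_zero [simp]: "eval_poly 0 x = 0"
  by (simp add: eval_poly_def)

lemma eval_poly_add [simp]: "eval_poly (p + q) x = eval_poly p x + eval_poly q x"
  using keys_add[of p q]
  by (simp add: eval_poly_superset[of "Poly_Mapping.keys p \<union> Poly_Mapping.keys q"]
      lookup_add distrib_right sum.distrib)

lemma eval_poly_sum [simp]: "eval_poly (\<Sum>a\<in>A. f a) x = (\<Sum>a\<in>A. eval_poly (f a) x)"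
  by (induction A rule: infinite_finite_induct) auto

lemma poly_mapping_sum_single:
  fixes p :: "'a \<Rightarrow>\<^sub>0 'b::comm_monoid_add"
  shows "p = (\<Sum>k\<in>Poly_Mapping.keys p. Poly_Mapping.single k (Poly_Mapping.lookup p k))"
  by (rule poly_mapping_eqI)
     (auto simp: lookup_sum lookup_single when_def sum.delta in_keys_iff)

lemma eval_poly_mult [simp]: "eval_poly (p * q) x = eval_poly p x * eval_poly q x"
proof -
  have monomials: "eval_poly (Poly_Mapping.single k c * Poly_Mapping.single l c') x =
      eval_poly (Poly_Mapping.single k c) x * eval_poly (Poly_Mapping.single l c') x" for k l c c'
    by (simp add: mult_single eval_poly_single lookup_add power_add prod.distrib)
  have "eval_poly (p * q) x =
      eval_poly ((\<Sum>k\<in>Poly_Mapping.keys p. Poly_Mapping.single k (Poly_Mapping.lookup p k)) *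
                 (\<Sum>k\<in>Poly_Mapping.keys q. Poly_Mapping.single k (Poly_Mapping.lookup q k))) x"
    using poly_mapping_sum_single[of p] poly_mapping_sum_single[of q] by simp
  also have "\<dots> = eval_poly (\<Sum>k\<in>Poly_Mapping.keys p. Poly_Mapping.single k (Poly_Mapping.lookup p k)) x *
      eval_poly (\<Sum>k\<in>Poly_Mapping.keys q. Poly_Mapping.single k (Poly_Mapping.lookup q k)) x"
    by (simp add: sum_product monomials)
  finally show ?thesis
    using poly_mapping_sum_single[of p] poly_mapping_sum_single[of q] by simp
qed

lemma eval_poly_const [simp]: "eval_poly (Poly_Mapping.single 0 c) x = c"
  by (simp add: eval_poly_single)

lemma eval_poly_one [simp]: "eval_poly 1 x = 1"
  by (metis eval_poly_const single_one)

lemma eval_poly_prod [simp]: "eval_poly (\<Prod>a\<in>A. f a) x = (\<Prod>a\<in>A. eval_poly (f a) x)"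
  by (induction A rule: infinite_finite_induct) auto

lemma eval_poly_X [simp]: "eval_poly (X j) x = of_real (x j)"
proof -
  have "(\<Prod>i\<in>UNIV. complex_of_real (x i) ^ (1 when j = i)) = (\<Prod>i\<in>{j}. of_real (x i))"
    by (rule prod.mono_neutral_cong_right) (auto simp: when_def)
  then show ?thesis by (simp add: X_def eval_poly_single lookup_single)
qed

lemma scale_eq_mult: "scale c p = Poly_Mapping.single 0 c * p"
  for p :: "'d mpoly"
  by (simp add: scale_def mult_map_scale_conv_mult)

lemma eval_poly_scale [simp]: "eval_poly (scale c p) x = c * eval_poly p x"
  by (simp add: scale_eq_mult)

lemma mult_scale_right: "q * scale c p = scale c (q * p)" for p q :: "'d mpoly"
  by (simp add: scale_eq_mult ac_simps)

lemma eval_poly_uminus [simp]: "eval_poly (- p) x = - eval_poly p x"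
  using eval_poly_add[of p "- p" x] by (simp add: eq_neg_iff_add_eq_0 add.commute)

lemma eval_poly_diff [simp]: "eval_poly (p - q) x = eval_poly p x - eval_poly q x"
  using eval_poly_add[of p "- q" x] by simp

lemma eval_poly_star [simp]: "eval_poly (star p) x = cnj (eval_poly p x)"
proof -
  have lookup: "Poly_Mapping.lookup (star p) m = cnj (Poly_Mapping.lookup p m)" for m
    by (simp add: star_def Poly_Mapping.map.rep_eq when_def)
  then have "Poly_Mapping.keys (star p) \<subseteq> Poly_Mapping.keys p"
    by (auto simp: in_keys_iff)
  then show ?thesis
    by (simp add: eval_poly_superset[of "Poly_Mapping.keys p"] lookup)
qed

lemma pinner_eq: "pinner \<mu> p q = (LINT x|\<mu>. cnj (eval_poly p x) * eval_poly q x)"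
  by (simp add: pinner_def state_def)


section \<open>Monic orthogonal polynomials\<close>

text \<open>The recursion is stated in an arbitrary commutative ring, so that the same function gives
  the numbers obtained by evaluation at a point and the polynomials in the indeterminate
  \<open>X j\<close>; ring homomorphisms carry one to the other.\<close>

fun monic_rec :: "'a::comm_ring_1 \<Rightarrow> (nat \<Rightarrow> 'a) \<Rightarrow> (nat \<Rightarrow> 'a) \<Rightarrow> nat \<Rightarrow> 'a" where
  "monic_rec x a b 0 = 1"
| "monic_rec x a b (Suc 0) = x - a 0"
| "monic_rec x a b (Suc (Suc n)) =
     (x - a (Suc n)) * monic_rec x a b (Suc n) - b n * monic_rec x a b n"

lemma monic_rec_times:
  "x * monic_rec x a b n =
     monic_rec x a b (Suc n) + a n * monic_rec x a b n +
     (if n = 0 then 0 else b (n - 1) * monic_rec x a b (n - 1))"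
  by (cases n) (simp_all add: algebra_simps)

lemma eval_poly_monic_rec:
  "eval_poly (monic_rec p a b n) x =
     monic_rec (eval_poly p x) (\<lambda>k. eval_poly (a k) x) (\<lambda>k. eval_poly (b k) x) n"
  by (induction n rule: induct_nat_012) auto

text \<open>Multiplying the orthonormal polynomial of degree \<open>n\<close> by the product of the first \<open>n\<close>
  coefficients \<open>\<beta>\<close> makes it monic.\<close>

lemma monic_rec_favard:
  assumes "favard_sequences \<nu> a b p"
  shows "monic_rec z (\<lambda>k. of_real (a k)) (\<lambda>k. of_real ((b k)\<^sup>2)) n =
    of_real (\<Prod>k<n. b k) * poly (p n) z"
proof -
  have rec: "z * poly (p n) z = of_real (b n) * poly (p (Suc n)) z + of_real (a n) * poly (p n) z +
      (if n = 0 then 0 else of_real (b (n - 1)) * poly (p (n - 1)) z)" for n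
  proof -
    have "poly ([:0, 1:] * p n) z = poly (smult (of_real (b n)) (p (Suc n)) + smult (of_real (a n)) (p n) +
            (if n = 0 then 0 else smult (of_real (b (n - 1))) (p (n - 1)))) z"
      using assms unfolding favard_sequences_def by presburger
    then show ?thesis by (simp split: if_splits)
  qed
  have p0: "p 0 = 1" using assms by (simp add: favard_sequences_def)
  show ?thesis
  proof (induction n rule: induct_nat_012)
    case 0
    show ?case by (simp add: p0)
  next
    case 1
    show ?case using rec[of 0] by (simp add: p0 algebra_simps)
  next
    case (ge2 n)
    have "of_real (b (Suc n)) * poly (p (Suc (Suc n))) z =
        (z - of_real (a (Suc n))) * poly (p (Suc n)) z - of_real (b n) * poly (p n) z"
      using rec[of "Suc n"] by (simp add: algebra_simps)
    then have "of_real (\<Prod>k<Suc (Suc n). b k) * poly (p (Suc (Suc n))) z =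
        of_real (\<Prod>k<Suc n. b k) *
          ((z - of_real (a (Suc n))) * poly (p (Suc n)) z - of_real (b n) * poly (p n) z)"
      by (simp add: mult.assoc)
    moreover have "of_real (\<Prod>k<Suc n. b k) * of_real (b n) * poly (p n) z =
        of_real ((b n)\<^sup>2) * (of_real (\<Prod>k<n. b k) * poly (p n) z)"
      by (simp add: power2_eq_square)
    ultimately show ?case
      unfolding monic_rec.simps ge2 by (simp only: right_diff_distrib left_diff_distrib ac_simps)
  qed
qed

text \<open>The normalizing factors are real and can be taken out of the integral, which leaves the
  orthonormality relations.\<close>

lemma integral_monic_rec:
  fixes \<nu> :: "real measure"
  assumes "favard_sequences \<nu> a b p"
  defines "f \<equiv> \<lambda>n x. monic_rec (complex_of_real x) (\<lambda>k. of_real (a k)) (\<lambda>k. of_real ((b k)\<^sup>2)) n"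
  shows "(LINT x|\<nu>. cnj (f m x) * f n x) = (if m = n then of_real ((\<Prod>k<n. b k)\<^sup>2) else 0)"
proof -
  have "(LINT x|\<nu>. cnj (f m x) * f n x) =
      (LINT x|\<nu>. of_real ((\<Prod>k<m. b k) * (\<Prod>k<n. b k)) *
         (cnj (poly (p m) (of_real x)) * poly (p n) (of_real x)))"
    unfolding f_def monic_rec_favard[OF assms(1)]
    by (rule Bochner_Integration.integral_cong) (auto simp: ac_simps)
  also have "\<dots> = of_real ((\<Prod>k<m. b k) * (\<Prod>k<n. b k)) * of_bool (m = n)"
    using assms(1) by (simp add: favard_sequences_def)
  finally show ?thesis by (simp add: power2_eq_square)
qed


section \<open>Product polynomials\<close>

locale product_favard =
  fixes \<mu> :: "'d::finite \<Rightarrow> real measure"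
    and \<alpha> \<beta> :: "'d \<Rightarrow> nat \<Rightarrow> real"
    and P :: "'d \<Rightarrow> nat \<Rightarrow> complex poly"
  assumes prob: "\<And>k. prob_space (\<mu> k)"
    and moments: "\<And>k r. integrable (\<mu> k) (\<lambda>x. x ^ r)"
    and favard: "\<And>k. favard_sequences (\<mu> k) (\<alpha> k) (\<beta> k) (P k)"
begin

abbreviation \<nu> :: "('d \<Rightarrow> real) measure" where
  "\<nu> \<equiv> Pi\<^sub>M UNIV \<mu>"

lemma product_sigma_finite: "product_sigma_finite \<mu>"
  unfolding product_sigma_finite_def
  using prob prob_space_imp_sigma_finite by blast

text \<open>A monomial is a product of functions of one coordinate each, so its integrability
  reduces to the one-dimensional moments.\<close>

lemma integrable_eval_poly: "integrable \<nu> (eval_poly p)"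
proof -
  interpret product_sigma_finite \<mu> by (rule product_sigma_finite)
  have "integrable \<nu> (\<lambda>x. \<Prod>j\<in>UNIV. complex_of_real (x j) ^ Poly_Mapping.lookup m j)" for m
  proof (rule product_integrable_prod)
    show "integrable (\<mu> j) (\<lambda>x. complex_of_real x ^ Poly_Mapping.lookup m j)" for j
      using integrable_of_real[OF moments[of j "Poly_Mapping.lookup m j"], where 'a = complex]
      by simp
  qed simp
  then show ?thesis
    unfolding eval_poly_def by (intro Bochner_Integration.integrable_sum integrable_mult_right)
qed

lemma integrable_pinner: "integrable \<nu> (\<lambda>x. cnj (eval_poly p x) * eval_poly q x)"
  using integrable_eval_poly[of "star p * q"] by (simp cong: Bochner_Integration.integrable_cong)

lemma pinner_add_right: "pinner \<nu> p (q + r) = pinner \<nu> p q + pinner \<nu> p r"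
  by (simp add: pinner_eq distrib_left Bochner_Integration.integral_add integrable_pinner)

lemma pinner_scale_right: "pinner \<nu> p (scale c q) = c * pinner \<nu> p q"
  by (simp add: pinner_eq mult.left_commute)

lemma pinner_diff_right: "pinner \<nu> p (q - r) = pinner \<nu> p q - pinner \<nu> p r"
  by (simp add: pinner_eq right_diff_distrib Bochner_Integration.integral_diff integrable_pinner)

lemma pinner_sum_right: "pinner \<nu> p (\<Sum>a\<in>A. f a) = (\<Sum>a\<in>A. pinner \<nu> p (f a))"
  by (simp add: pinner_eq sum_distrib_left Bochner_Integration.integral_sum integrable_pinner)

lemma pinner_zero_right [simp]: "pinner \<nu> p 0 = 0"
  by (simp add: pinner_eq)

lemma cnj_pinner: "cnj (pinner \<nu> p q) = pinner \<nu> q p"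
  unfolding pinner_eq using Bochner_Integration.integral_cnj[of \<nu> "\<lambda>x. cnj (eval_poly p x) * eval_poly q x"]
  by (simp add: mult.commute)

lemma pinner_scale_left: "pinner \<nu> (scale c p) q = cnj c * pinner \<nu> p q"
  by (metis cnj_pinner pinner_scale_right complex_cnj_mult)

lemma pinner_sum_left: "pinner \<nu> (\<Sum>a\<in>A. f a) q = (\<Sum>a\<in>A. pinner \<nu> (f a) q)"
  by (simp add: pinner_eq sum_distrib_right Bochner_Integration.integral_sum integrable_pinner)

lemma pinner_span_right:
  assumes "q \<in> free_vs.span A" "\<And>a. a \<in> A \<Longrightarrow> pinner \<nu> p a = 0"
  shows "pinner \<nu> p q = 0"
  using assms(1)
  by (induction rule: free_vs.span_induct_alt)
     (simp_all add: pinner_add_right pinner_scale_right assms(2))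

lemma pinner_span_left:
  assumes "p \<in> free_vs.span A" "\<And>a. a \<in> A \<Longrightarrow> pinner \<nu> a q = 0"
  shows "pinner \<nu> p q = 0"
  using pinner_span_right[of p A q] assms cnj_pinner[of p q] cnj_pinner
  by (metis complex_cnj_zero)

text \<open>Multisets over \<open>'d\<close> serve as multi-indices, because the multiset of the entries of a tuple
  is a complete invariant of the class of that tuple. The polynomial with index \<open>M\<close> is the product
  over \<open>r\<close> of the monic orthogonal polynomials of degree \<open>count M r\<close> of the measures \<open>\<mu> r\<close>.\<close>

definition Q :: "'d multiset \<Rightarrow> 'd mpoly" where
  "Q M = (\<Prod>r\<in>UNIV. monic_rec (X r) (\<lambda>k. Poly_Mapping.single 0 (of_real (\<alpha> r k)))
            (\<lambda>k. Poly_Mapping.single 0 (of_real ((\<beta> r k)\<^sup>2))) (count M r))"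

definition Q_norm2 :: "'d multiset \<Rightarrow> real" where
  "Q_norm2 M = (\<Prod>r\<in>UNIV. (\<Prod>k<count M r. \<beta> r k)\<^sup>2)"

lemma Q_norm2_pos: "Q_norm2 M > 0"
proof -
  have "\<beta> r k > 0" for r k
    using favard[of r] by (simp add: favard_sequences_def)
  then show ?thesis
    unfolding Q_norm2_def by (intro prod_pos ballI zero_less_power) auto
qed

lemma Q_empty: "Q {#} = 1"
  by (simp add: Q_def)

text \<open>By Fubini, the integral is the product of the one-dimensional integrals, and one of these
  vanishes as soon as the multiplicities differ at some index.\<close>

lemma pinner_Q: "pinner \<nu> (Q M) (Q N) = (if M = N then of_real (Q_norm2 N) else 0)"
proof -
  interpret product_sigma_finite \<mu> by (rule product_sigma_finite)
  define f where "f \<equiv> \<lambda>r n x. monic_rec (complex_of_real x)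
    (\<lambda>k. of_real (\<alpha> r k)) (\<lambda>k. of_real ((\<beta> r k)\<^sup>2)) n"
  have int: "integrable (\<mu> r) (\<lambda>x. cnj (f r m x) * f r n x)" for r m n
  proof -
    have eq: "(\<lambda>x. cnj (f r m x) * f r n x) =
      (\<lambda>x. poly (smult (of_real ((\<Prod>k<m. \<beta> r k) * (\<Prod>k<n. \<beta> r k))) (map_poly cnj (P r m) * P r n)) (of_real x))"
    proof
      fix x
      have "cnj (poly (P r m) (of_real x)) = poly (map_poly cnj (P r m)) (of_real x)"
        using poly_cnj[of "P r m" "of_real x"] by simp
      then show "cnj (f r m x) * f r n x = poly (smult (of_real ((\<Prod>k<m. \<beta> r k) * (\<Prod>k<n. \<beta> r k)))
          (map_poly cnj (P r m) * P r n)) (of_real x)"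
        unfolding f_def monic_rec_favard[OF favard] by simp
    qed
    show ?thesis
      unfolding eq poly_altdef
    proof (intro Bochner_Integration.integrable_sum integrable_mult_right)
      show "integrable (\<mu> r) (\<lambda>x. complex_of_real x ^ i)" for i
        using integrable_of_real[OF moments[of r i], where 'a = complex] by simp
    qed
  qed
  have eval: "eval_poly (Q M) x = (\<Prod>r\<in>UNIV. f r (count M r) (x r))" for M x
    by (simp add: Q_def eval_poly_monic_rec f_def)
  have "pinner \<nu> (Q M) (Q N) =
      (LINT x|\<nu>. (\<Prod>r\<in>UNIV. cnj (f r (count M r) (x r)) * f r (count N r) (x r)))"
    by (simp add: pinner_eq eval prod.distrib)
  also have "\<dots> = (\<Prod>r\<in>UNIV. LINT x|\<mu> r. cnj (f r (count M r) x) * f r (count N r) x)"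
    by (rule product_integral_prod) (auto intro: int)
  also have "\<dots> = (\<Prod>r\<in>UNIV. if count M r = count N r then of_real ((\<Prod>k<count N r. \<beta> r k)\<^sup>2) else 0)"
    unfolding f_def integral_monic_rec[OF favard] ..
  also have "\<dots> = (if M = N then of_real (Q_norm2 N) else 0)"
  proof (cases "M = N")
    case False
    then obtain r where "count M r \<noteq> count N r" by (auto simp: multiset_eq_iff)
    then show ?thesis using False by (auto intro!: bexI[of _ r])
  qed (simp add: Q_norm2_def)
  finally show ?thesis .
qed

lemma Q_inject: "Q M = Q N \<Longrightarrow> M = N"
  using pinner_Q[of N N] pinner_Q[of N M] Q_norm2_pos[of N] by (auto split: if_splits)

text \<open>Only the factor with index \<open>j\<close> changes; the remaining factors \<open>R\<close> are common to all the
  terms.\<close>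

lemma X_mult_Q:
  "X j * Q M = Q (add_mset j M) + scale (of_real (\<alpha> j (count M j))) (Q M) +
     (if j \<in># M then scale (of_real ((\<beta> j (count M j - 1))\<^sup>2)) (Q (M - {#j#})) else 0)"
proof -
  define f where "f \<equiv> \<lambda>r. monic_rec (X r :: 'd mpoly) (\<lambda>k. Poly_Mapping.single 0 (of_real (\<alpha> r k)))
            (\<lambda>k. Poly_Mapping.single 0 (of_real ((\<beta> r k)\<^sup>2)))"
  define R where "R \<equiv> \<Prod>r\<in>UNIV - {j}. f r (count M r)"
  have Q: "Q N = f j (count N j) * R" if "\<And>r. r \<noteq> j \<Longrightarrow> count N r = count M r" for N
    proof -
    have "Q N = (\<Prod>r\<in>UNIV. f r (count N r))" by (simp add: Q_def f_def)
    also have "\<dots> = f j (count N j) * (\<Prod>r\<in>UNIV - {j}. f r (count N r))"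
      by (rule prod.remove) auto
    also have "(\<Prod>r\<in>UNIV - {j}. f r (count N r)) = R"
      unfolding R_def using that by (intro prod.cong) auto
    finally show ?thesis .
  qed
  have rec: "X j * f j n = f j (Suc n) + scale (of_real (\<alpha> j n)) (f j n) +
      (if n = 0 then 0 else scale (of_real ((\<beta> j (n - 1))\<^sup>2)) (f j (n - 1)))" for n
    unfolding f_def by (simp add: scale_eq_mult monic_rec_times)
  have Q': "Q M = f j (count M j) * R" "Q (add_mset j M) = f j (Suc (count M j)) * R"
    "Q (M - {#j#}) = f j (count M j - 1) * R"
    by (subst Q; simp)+
  have "X j * Q M = (X j * f j (count M j)) * R"
    by (simp add: Q' ac_simps)
  also have "\<dots> = f j (Suc (count M j)) * R + scale (of_real (\<alpha> j (count M j))) (f j (count M j) * R) +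
      (if count M j = 0 then 0 else scale (of_real ((\<beta> j (count M j - 1))\<^sup>2)) (f j (count M j - 1) * R))"
    unfolding rec by (simp only: scale_eq_mult distrib_right mult.assoc if_distrib[of "\<lambda>p. p * R"] mult_zero_left)
  also have "count M j = 0 \<longleftrightarrow> j \<notin># M" by (rule count_eq_zero_iff)
  finally show ?thesis unfolding Q' by simp
qed


section \<open>The gradation\<close>

text \<open>Products with \<open>X j\<close> let both inclusions between the spans of the monomials and of the \<open>Q M\<close>
  be proved by induction on the degree.\<close>

lemma X_mult_span:
  assumes "p \<in> free_vs.span A" "\<And>a. a \<in> A \<Longrightarrow> X j * a \<in> free_vs.span B"
  shows "X j * p \<in> free_vs.span B"
  using assms(1)
  by (induction rule: free_vs.span_induct_alt)
     (simp_all add: distrib_left mult_scale_right free_vs.span_zero free_vs.span_add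
        free_vs.span_scale assms(2))

lemma X_mult_Q_span:
  assumes "size M \<le> n"
  shows "X j * Q M \<in> free_vs.span (Q ` {M. size M \<le> Suc n})"
proof -
  have "Q N \<in> free_vs.span (Q ` {M. size M \<le> Suc n})" if "size N \<le> Suc n" for N
    using that by (intro free_vs.span_base) auto
  then show ?thesis
    using assms unfolding X_mult_Q
    by (auto intro!: free_vs.span_add free_vs.span_scale free_vs.span_zero simp: size_Diff_singleton_if)
qed

lemma X_mult_polys_le:
  fixes p :: "'d mpoly"
  assumes "p \<in> polys_le n"
  shows "X j * p \<in> polys_le (Suc n)"
  unfolding polys_le_def
proof (rule X_mult_span)
  show "p \<in> free_vs.span {Poly_Mapping.single m 1 |m. sum (Poly_Mapping.lookup m) UNIV \<le> n}"
    using assms by (simp add: polys_le_def)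
next
  fix a :: "'d mpoly" assume "a \<in> {Poly_Mapping.single m 1 |m. sum (Poly_Mapping.lookup m) UNIV \<le> n}"
  then obtain m where m: "a = Poly_Mapping.single m 1" "sum (Poly_Mapping.lookup m) UNIV \<le> n"
    by auto
  have "(\<Sum>i\<in>UNIV. Poly_Mapping.lookup (Poly_Mapping.single j (1::nat) + m) i) = 
     Suc (sum (Poly_Mapping.lookup m) UNIV)"
    by (simp add: lookup_add sum.distrib lookup_single when_def)
  then show "X j * a \<in> free_vs.span {Poly_Mapping.single m 1 |m. sum (Poly_Mapping.lookup m) UNIV \<le> Suc n}"
    using m by (intro free_vs.span_base) (auto simp: X_def mult_single)
qed

lemma polys_le_mono: "m \<le> n \<Longrightarrow> polys_le m \<subseteq> polys_le n"
  unfolding polys_le_def by (intro free_vs.span_mono) auto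

text \<open>Solving the three-term recursion for its leading term expresses \<open>Q M\<close> by a product with some
  \<open>X j\<close> and by polynomials of smaller index.\<close>

lemma Q_in_polys_le: "Q M \<in> polys_le (size M)"
proof (induction "size M" arbitrary: M rule: less_induct)
  case less
  note sub = free_vs.span_add free_vs.span_diff free_vs.span_scale free_vs.span_zero
  show ?case
  proof (cases M)
    case empty
    have "(1 :: 'd mpoly) \<in> polys_le 0"
      unfolding polys_le_def by (rule free_vs.span_base) (auto intro!: exI[of _ 0])
    then show ?thesis using empty by (simp add: Q_empty)
  next
    case (add j N)
    have N: "X j * Q N \<in> polys_le (size M)" "Q N \<in> polys_le (size M)"
      using less[of N] X_mult_polys_le[of "Q N" "size N" j] polys_le_mono[of "size N" "size M"]
      by (auto simp: add)
    have "size (N - {#j#}) < size M"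
      by (auto simp: add size_Diff_singleton_if)
    then have N': "Q (N - {#j#}) \<in> polys_le (size M)"
      using less[of "N - {#j#}"] polys_le_mono[of "size (N - {#j#})" "size M"] by auto
    have "Q M = X j * Q N - scale (of_real (\<alpha> j (count N j))) (Q N) -
      (if j \<in># N then scale (of_real ((\<beta> j (count N j - 1))\<^sup>2)) (Q (N - {#j#})) else 0)"
      unfolding X_mult_Q by (simp add: add)
    also have "\<dots> \<in> polys_le (size M)"
      using N N' unfolding polys_le_def by (auto intro!: sub)
    finally show ?thesis .
  qed
qed

lemma monomial_in_span_Q:
  "Poly_Mapping.single m 1 \<in> free_vs.span (Q ` {M. size M \<le> (\<Sum>j\<in>UNIV. Poly_Mapping.lookup m j)})"
proof (induction "\<Sum>j\<in>UNIV. Poly_Mapping.lookup m j" arbitrary: m)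
  case 0
  then have "m = 0" by (intro poly_mapping_eqI) simp
  then show ?case
    by (intro free_vs.span_base) (auto simp: Q_empty intro!: image_eqI[of _ _ "{#}"])
next
  case (Suc n)
  then obtain j where j: "Poly_Mapping.lookup m j > 0"
    by (metis (mono_tags, lifting) gr0I nat.distinct(1) sum.neutral)
  define m' where "m' = m - Poly_Mapping.single j 1"
  have m: "m = Poly_Mapping.single j 1 + m'"
    using j unfolding m'_def
    by (intro poly_mapping_eqI) (auto simp: lookup_add lookup_minus lookup_single when_def)
  have "(\<Sum>i\<in>UNIV. Poly_Mapping.lookup (Poly_Mapping.single j (1::nat) + m') i) = 
     Suc (sum (Poly_Mapping.lookup m') UNIV)"
    by (simp add: lookup_add sum.distrib lookup_single when_def)
  then have n: "n = sum (Poly_Mapping.lookup m') UNIV" using Suc(2) m by simp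
  have "X j * Poly_Mapping.single m' 1 \<in> free_vs.span (Q ` {M. size M \<le> Suc n})"
    by (rule X_mult_span[OF Suc(1)[OF n]]) (use n X_mult_Q_span in auto)
  moreover have "X j * Poly_Mapping.single m' 1 = Poly_Mapping.single m 1"
    unfolding m X_def by (simp add: mult_single)
  ultimately show ?case using Suc(2) by simp
qed

lemma polys_le_eq_span_Q: "polys_le n = free_vs.span (Q ` {M. size M \<le> n})"
proof
  show "polys_le n \<subseteq> free_vs.span (Q ` {M. size M \<le> n})"
    unfolding polys_le_def
  proof (intro free_vs.span_minimal free_vs.subspace_span subsetI)
    fix a :: "'d mpoly" assume "a \<in> {Poly_Mapping.single m 1 |m. sum (Poly_Mapping.lookup m) UNIV \<le> n}"
    then obtain m where m: "a = Poly_Mapping.single m 1" "sum (Poly_Mapping.lookup m) UNIV \<le> n"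
      by auto
    then show "a \<in> free_vs.span (Q ` {M. size M \<le> n})"
      using monomial_in_span_Q[of m] 
        free_vs.span_mono[of "Q ` {M. size M \<le> sum (Poly_Mapping.lookup m) UNIV}" "Q ` {M. size M \<le> n}"]
      by fastforce
  qed
  show "free_vs.span (Q ` {M. size M \<le> n}) \<subseteq> polys_le n"
    unfolding polys_le_def
  proof (intro free_vs.span_minimal free_vs.subspace_span)
    show "Q ` {M. size M \<le> n} \<subseteq> free_vs.span {Poly_Mapping.single m 1 |m. sum (Poly_Mapping.lookup m) UNIV \<le> n}"
      using Q_in_polys_le polys_le_mono unfolding polys_le_def by blast
  qed
qed

text \<open>Finiteness, which relies on the finite index type, makes elements of the spans into plain
  finite sums over all multi-indices.\<close>

lemma finite_size_eq: "finite {M :: 'd multiset. size M = n}"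
proof -
  have "{M :: 'd multiset. size M = n} = mset ` {w. length w = n}"
    by (auto simp: image_iff) (metis ex_mset size_mset)
  then show ?thesis by (simp add: finite_words)
qed

lemma finite_size_le: "finite {M :: 'd multiset. size M \<le> n}"
proof -
  have "{M :: 'd multiset. size M \<le> n} = (\<Union>k\<le>n. {M. size M = k})" by auto
  then show ?thesis using finite_size_eq by simp
qed

lemma span_Q_expansion:
  assumes "finite S" "p \<in> free_vs.span (Q ` S)"
  obtains c where "p = (\<Sum>M\<in>S. scale (c M) (Q M))"
proof -
  have "inj_on Q S" using Q_inject by (auto intro: inj_onI)
  moreover obtain u where "p = (\<Sum>v\<in>Q ` S. scale (u v) v)"
    using assms free_vs.span_finite[of "Q ` S"] by auto
  ultimately have "p = (\<Sum>M\<in>S. scale (u (Q M)) (Q M))"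
    by (simp add: sum.reindex)
  then show ?thesis by (rule that)
qed

text \<open>Fourier coefficients: the scalar product with \<open>Q N\<close> singles out the coefficient of
  \<open>Q N\<close>.\<close>

lemma pinner_Q_expansion:
  assumes "finite S" "N \<in> S"
  shows "pinner \<nu> (Q N) (\<Sum>M\<in>S. scale (c M) (Q M)) = c N * of_real (Q_norm2 N)"
proof -
  have "pinner \<nu> (Q N) (\<Sum>M\<in>S. scale (c M) (Q M)) =
      (\<Sum>M\<in>S. if N = M then c M * of_real (Q_norm2 M) else 0)"
    by (auto simp: pinner_sum_right pinner_scale_right pinner_Q intro!: sum.cong)
  then show ?thesis using assms by (simp add: sum.delta')
qed

lemma span_Q_eq_zero:
  assumes "finite S" "p \<in> free_vs.span (Q ` S)" "\<And>M. M \<in> S \<Longrightarrow> pinner \<nu> (Q M) p = 0"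
  shows "p = 0"
proof -
  obtain c where c: "p = (\<Sum>M\<in>S. scale (c M) (Q M))"
    using span_Q_expansion assms by blast
  have "c M = 0" if "M \<in> S" for M
    using assms(3)[OF that] pinner_Q_expansion[OF assms(1) that, of c] Q_norm2_pos[of M] by (simp add: c)
  then show ?thesis by (simp add: c)
qed

text \<open>The product polynomials are orthogonal and, together, span each \<open>polys_le n\<close>; those of
  total degree exactly \<open>n\<close> therefore span the orthogonal complement of the lower degrees.\<close>

lemma graded_part_eq_span_Q: "graded_part \<nu> n = free_vs.span (Q ` {M. size M = n})"
proof
  show "graded_part \<nu> n \<subseteq> free_vs.span (Q ` {M. size M = n})"
  proof
    fix p assume p: "p \<in> graded_part \<nu> n"
    then obtain c where c: "p = (\<Sum>M | size M \<le> n. scale (c M) (Q M))"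
      using span_Q_expansion[OF finite_size_le] by (auto simp: graded_part_def polys_le_eq_span_Q)
    have "c M = 0" if "size M < n" for M
    proof -
      have "Q M \<in> polys_le (n - 1)"
        using that Q_in_polys_le[of M] polys_le_mono[of "size M" "n - 1"] by fastforce
      then have "pinner \<nu> (Q M) p = 0" using p that by (auto simp: graded_part_def split: if_splits)
      then show ?thesis
        using pinner_Q_expansion[OF finite_size_le[of n], of M c] that Q_norm2_pos[of M] by (simp add: c)
    qed
    then have "p = (\<Sum>M | size M = n. scale (c M) (Q M))"
      unfolding c by (intro sum.mono_neutral_right finite_size_le) (auto simp: order_le_less)
    also have "\<dots> \<in> free_vs.span (Q ` {M. size M = n})"
      by (intro free_vs.span_sum free_vs.span_scale free_vs.span_base) auto
    finally show "p \<in> free_vs.span (Q ` {M. size M = n})" .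
  qed
next
  show "free_vs.span (Q ` {M. size M = n}) \<subseteq> graded_part \<nu> n"
  proof
    fix p assume p: "p \<in> free_vs.span (Q ` {M. size M = n})"
    then have "p \<in> polys_le n"
      unfolding polys_le_eq_span_Q using free_vs.span_mono[of "Q ` {M. size M = n}" "Q ` {M. size M \<le> n}"]
      by auto
    moreover have "pinner \<nu> q p = 0" if q: "q \<in> polys_le (n - 1)" and n: "n \<noteq> 0" for q
    proof (rule pinner_span_right[OF p])
      fix a assume "a \<in> Q ` {M. size M = n}"
      then show "pinner \<nu> q a = 0"
        using n by (intro pinner_span_left[OF q[unfolded polys_le_eq_span_Q]]) (auto simp: pinner_Q)
    qed
    moreover have "pinner \<nu> 0 p = 0" by (simp add: pinner_eq)
    ultimately show "p \<in> graded_part \<nu> n"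
      unfolding graded_part_def by (cases "n = 0") auto
  qed
qed

lemma Q_in_graded_part: "Q M \<in> graded_part \<nu> (size M)"
  unfolding graded_part_eq_span_Q by (intro free_vs.span_base) auto

text \<open>The projection is a definite description. Two candidates differ by an element of the span of
  the \<open>Q M\<close> with \<open>size M = n\<close> that is orthogonal to all of them, so they agree. Testing
  orthogonality on the \<open>Q M\<close> is enough.\<close>

lemma proj_eqI:
  assumes "q \<in> graded_part \<nu> n" "\<And>M. size M = n \<Longrightarrow> pinner \<nu> (Q M) (p - q) = 0"
  shows "proj \<nu> n p = q"
  unfolding proj_def
proof (rule the_equality)
  show "q \<in> graded_part \<nu> n \<and> (\<forall>r\<in>graded_part \<nu> n. pinner \<nu> r (p - q) = 0)"
  proof (intro conjI ballI)
    fix r assume "r \<in> graded_part \<nu> n"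
    then have "r \<in> free_vs.span (Q ` {M. size M = n})"
      by (simp add: graded_part_eq_span_Q)
    then show "pinner \<nu> r (p - q) = 0"
      by (rule pinner_span_left) (use assms(2) in auto)
  qed (rule assms(1))
next
  fix q' assume q': "q' \<in> graded_part \<nu> n \<and> (\<forall>r\<in>graded_part \<nu> n. pinner \<nu> r (p - q') = 0)"
  have "q' - q = 0"
  proof (rule span_Q_eq_zero[OF finite_size_eq[of n]])
    show "q' - q \<in> free_vs.span (Q ` {M. size M = n})"
      using q' assms(1) unfolding graded_part_eq_span_Q by (auto intro: free_vs.span_diff)
    fix M :: "'d multiset" assume "M \<in> {M. size M = n}"
    then have "pinner \<nu> (Q M) (p - q) = 0" "pinner \<nu> (Q M) (p - q') = 0"
      using assms(2) q' Q_in_graded_part[of M] by auto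
    then show "pinner \<nu> (Q M) (q' - q) = 0" by (simp add: pinner_diff_right)
  qed
  then show "q' = q" by simp
qed

lemma proj_zero: "proj \<nu> n 0 = 0"
  by (rule proj_eqI) (auto simp: graded_part_eq_span_Q free_vs.span_zero)

lemma proj_graded_part:
  assumes "p \<in> graded_part \<nu> k"
  shows "proj \<nu> n p = (if n = k then p else 0)"
proof (rule proj_eqI)
  show "(if n = k then p else 0) \<in> graded_part \<nu> n"
    using assms by (auto simp: graded_part_eq_span_Q free_vs.span_zero)
next
  fix M :: "'d multiset" assume "size M = n"
  then have "pinner \<nu> (Q M) p = 0" if "n \<noteq> k"
    using assms[unfolded graded_part_eq_span_Q] that
    by (rule_tac pinner_span_right) (auto simp: pinner_Q)
  then show "pinner \<nu> (Q M) (p - (if n = k then p else 0)) = 0" by simp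
qed


section \<open>Creation and preservation operators\<close>

text \<open>On a homogeneous element only one term of the sum over all degrees is nonzero.\<close>

lemma creation_graded_part:
  assumes "p \<in> graded_part \<nu> k"
  shows "creation \<nu> j p = proj \<nu> (Suc k) (X j * p)"
proof -
  have "creation_at \<nu> n j p = (if n = k then proj \<nu> (Suc k) (X j * p) else 0)" for n
    by (simp add: creation_at_def proj_graded_part[OF assms] proj_zero)
  then show ?thesis
    unfolding creation_def by (subst Sum_any.expand_superset[of "{k}"]) auto
qed

lemma sum_Q_in_graded_part:
  assumes "\<And>a. a \<in> A \<Longrightarrow> size (f a) = k"
  shows "(\<Sum>a\<in>A. scale (c a) (Q (f a))) \<in> graded_part \<nu> k"
  unfolding graded_part_eq_span_Q using assms
  by (intro free_vs.span_sum free_vs.span_scale free_vs.span_base) auto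

text \<open>The other two terms of the three-term recursion have lower degree, so the projection
  defining the creation operator removes them.\<close>

lemma creation_sum_Q:
  assumes "\<And>a. a \<in> A \<Longrightarrow> size (f a) = k"
  shows "creation \<nu> j (\<Sum>a\<in>A. scale (c a) (Q (f a))) = (\<Sum>a\<in>A. scale (c a) (Q (add_mset j (f a))))"
proof -
  have "proj \<nu> (Suc k) (X j * (\<Sum>a\<in>A. scale (c a) (Q (f a)))) =
      (\<Sum>a\<in>A. scale (c a) (Q (add_mset j (f a))))"
  proof (rule proj_eqI)
    show "(\<Sum>a\<in>A. scale (c a) (Q (add_mset j (f a)))) \<in> graded_part \<nu> (Suc k)"
      using assms by (intro sum_Q_in_graded_part) auto
  next
    fix M :: "'d multiset" assume M: "size M = Suc k"
    have "pinner \<nu> (Q M) (X j * Q (f a)) = pinner \<nu> (Q M) (Q (add_mset j (f a)))" if "a \<in> A" for a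
    proof -
      have "M \<noteq> f a" "M \<noteq> f a - {#j#}"
        using assms[OF that] M size_mset_mono[OF diff_subset_eq_self, of "f a" "{#j#}"] by auto
      then show ?thesis
        unfolding X_mult_Q by (simp add: pinner_add_right pinner_scale_right pinner_Q)
    qed
    then show "pinner \<nu> (Q M) (X j * (\<Sum>a\<in>A. scale (c a) (Q (f a))) -
        (\<Sum>a\<in>A. scale (c a) (Q (add_mset j (f a))))) = 0"
      by (simp add: pinner_diff_right sum_distrib_left mult_scale_right pinner_sum_right
          pinner_scale_right)
  qed
  then show ?thesis
    using creation_graded_part[OF sum_Q_in_graded_part[of A f k c, OF assms]] by simp
qed

text \<open>The projection onto the component of \<open>Q M\<close> keeps only the middle term of the three-term
  recursion.\<close>

lemma preservation_Q:
  "preservation_at \<nu> (size M) l (Q M) = scale (of_real (\<alpha> l (count M l))) (Q M)"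
proof -
  have "proj \<nu> (size M) (X l * Q M) = scale (of_real (\<alpha> l (count M l))) (Q M)"
  proof (rule proj_eqI)
    show "scale (of_real (\<alpha> l (count M l))) (Q M) \<in> graded_part \<nu> (size M)"
      using Q_in_graded_part[of M] by (simp add: graded_part_eq_span_Q free_vs.span_scale)
  next
    fix N :: "'d multiset" assume "size N = size M"
    then have "N \<noteq> add_mset l M" "l \<in># M \<Longrightarrow> N \<noteq> M - {#l#}"
      using size_Suc_Diff1[of l M] by auto
    then show "pinner \<nu> (Q N) (X l * Q M - scale (of_real (\<alpha> l (count M l))) (Q M)) = 0"
      unfolding X_mult_Q by (simp add: pinner_add_right pinner_scale_right pinner_Q)
  qed
  then show ?thesis
    by (simp add: preservation_at_def proj_graded_part[OF Q_in_graded_part])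
qed

text \<open>Each creation operator of a vector prepends a letter to every word, with the corresponding
  coordinate as weight, so the coefficient of a word is a coordinate of the elementary tensor
  of the vectors.\<close>

lemma foldr_creation_vec:
  "foldr (creation_vec \<nu>) vs 1 =
     (\<Sum>w | length w = length vs. scale (\<Prod>k<length vs. (vs ! k) $ (w ! k)) (Q (mset w)))"
proof (induction vs)
  case Nil
  have "{w :: 'd list. length w = 0} = {[]}" by auto
  then show ?case by (simp add: Q_empty)
next
  case (Cons v vs)
  let ?c = "\<lambda>w. \<Prod>k<length vs. (vs ! k) $ (w ! k)"
  let ?W = "{w :: 'd list. length w = length vs}"
  have "foldr (creation_vec \<nu>) (v # vs) 1 =
      (\<Sum>j\<in>UNIV. scale (v $ j) (\<Sum>w\<in>?W. scale (?c w) (Q (add_mset j (mset w)))))"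
  proof -
    have "creation \<nu> j (foldr (creation_vec \<nu>) vs 1) = (\<Sum>w\<in>?W. scale (?c w) (Q (add_mset j (mset w))))" for j
      unfolding Cons.IH by (rule creation_sum_Q[where k = "length vs"]) simp
    then show ?thesis by (simp add: creation_vec_def[of _ v])
  qed
  also have "\<dots> = (\<Sum>(j, w)\<in>UNIV \<times> ?W. scale (v $ j * ?c w) (Q (add_mset j (mset w))))"
    by (simp add: free_vs.scale_sum_right sum.cartesian_product)
  also have "\<dots> = (\<Sum>w | length w = length (v # vs).
      scale (\<Prod>k<length (v # vs). ((v # vs) ! k) $ (w ! k)) (Q (mset w)))"
    by (rule sum.reindex_bij_witness[where j = "\<lambda>(j, w). j # w" and i = "\<lambda>w. (hd w, tl w)"])
       (auto simp: length_Suc_conv prod.lessThan_Suc_shift simp del: prod.lessThan_Suc)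
  finally show ?case .
qed

end


section \<open>Symmetric tensors\<close>

lemma sym_tensors_iff:
  "\<xi> \<in> sym_tensors n \<longleftrightarrow>
     (\<forall>w. length w \<noteq> n \<longrightarrow> Poly_Mapping.lookup \<xi> w = 0) \<and>
     (\<forall>\<pi> w. \<pi> permutes {..<n} \<longrightarrow> length w = n \<longrightarrow>
        Poly_Mapping.lookup \<xi> (permute_list \<pi> w) = Poly_Mapping.lookup \<xi> w)"
  by (auto simp: sym_tensors_def in_keys_iff)

lemma sym_tensors_subspace: "free_vs.subspace (sym_tensors n)"
  by (rule free_vs.subspaceI) (auto simp: sym_tensors_iff lookup_add)

lemma sum_constant_scale: "(\<Sum>a\<in>A. p) = scale (of_nat (card A)) p"
  by (rule poly_mapping_eqI) (simp add: lookup_sum del: sum_constant, simp)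

lemma linear_on_sum:
  assumes "linear_on S f" "free_vs.subspace S" "\<And>a. a \<in> A \<Longrightarrow> g a \<in> S"
  shows "f (\<Sum>a\<in>A. scale (c a) (g a)) = (\<Sum>a\<in>A. scale (c a) (f (g a)))"
  using assms(3)
proof (induction A rule: infinite_finite_induct)
  case (insert a A)
  have "(\<Sum>a\<in>A. scale (c a) (g a)) \<in> S"
    using insert by (intro free_vs.subspace_sum free_vs.subspace_scale assms(2)) auto
  moreover have "scale (c a) (g a) \<in> S"
    using insert by (intro free_vs.subspace_scale assms(2)) auto
  ultimately show ?case
    using insert assms(1) by (simp add: linear_on_def)
next
  have "f 0 = 0"
    using assms(1) free_vs.subspace_0[OF assms(2)] unfolding linear_on_def
    by (metis free_vs.scale_zero_left)
  { case (infinite A) then show ?case using \<open>f 0 = 0\<close> by simp }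
  { case empty then show ?case using \<open>f 0 = 0\<close> by simp }
qed

lemma sum_words_permute:
  fixes f :: "'d list \<Rightarrow> 'b::comm_monoid_add"
  assumes "\<pi> permutes {..<n}"
  shows "(\<Sum>w | length w = n. f (permute_list \<pi> w)) = (\<Sum>w | length w = n. f w)"
proof -
  have inv: "inv \<pi> permutes {..<n}" using assms by (rule permutes_inv)
  have "permute_list (inv \<pi>) (permute_list \<pi> w) = w" "permute_list \<pi> (permute_list (inv \<pi>) w) = w"
    if "length w = n" for w :: "'d list"
    using that assms inv permute_list_compose[of "inv \<pi>" w \<pi>] permute_list_compose[of \<pi> w "inv \<pi>"]
    by (simp_all add: permutes_inv_o)
  then show ?thesis
    by (intro sum.reindex_bij_witness[where i = "permute_list (inv \<pi>)" and j = "permute_list \<pi>"]) auto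
qed

text \<open>Invariance under permutations of positions means that a coordinate depends only on the
  letters of the word, with multiplicity.\<close>

lemma lookup_sym_tensor_mset_eq:
  assumes "\<xi> \<in> sym_tensors n" "mset v = mset w"
  shows "Poly_Mapping.lookup \<xi> v = Poly_Mapping.lookup \<xi> w"
proof (cases "length w = n")
  case True
  obtain \<pi> where "\<pi> permutes {..<length w}" "permute_list \<pi> w = v"
    using mset_eq_permutation[OF assms(2)] by metis
  then show ?thesis using assms(1) True by (auto simp: sym_tensors_def)
next
  case False
  moreover have "length v = length w" using assms(2) by (rule mset_eq_length)
  ultimately show ?thesis using assms(1) by (simp add: sym_tensors_iff)
qed

lemma cl_eq_iff:
  fixes v w :: "'a list"
  shows "cl v = cl w \<longleftrightarrow> mset v = mset w"
proof -
  have cl: "cl w = {v. mset v = mset w}" for w :: "'a list"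
  proof (intro set_eqI iffI)
    fix v assume "v \<in> {v. mset v = mset w}"
    then obtain \<pi> where "\<pi> permutes {..<length w}" "permute_list \<pi> w = v"
      using mset_eq_permutation[of v w] by auto
    then show "v \<in> cl w" by (auto simp: cl_def perm_rel_def)
  qed (auto simp: cl_def perm_rel_def)
  show ?thesis
  proof
    assume "cl v = cl w"
    moreover have "v \<in> cl v" by (simp add: cl)
    ultimately show "mset v = mset w" by (simp add: cl)
  qed (simp add: cl)
qed

text \<open>A symmetric tensor is its own symmetrization, and symmetrizing the expansion in the basis of
  elementary tensors replaces each of them by the symmetric product. Hence a linear map on
  symmetric tensors is determined by its values on symmetric products.\<close>

lemma sym_tensors_expansion:
  fixes \<xi> :: "'d::finite tensor"
  assumes "\<xi> \<in> sym_tensors n"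
  shows "\<xi> = (\<Sum>w | length w = n.
    scale (Poly_Mapping.lookup \<xi> w) (sym_prod (map (\<lambda>j. axis j 1) w)))"
proof (rule poly_mapping_eqI)
  fix v :: "'d list"
  let ?x = "Poly_Mapping.lookup \<xi>"
  let ?ax = "map (\<lambda>j. axis j 1 :: complex ^ 'd)"
  let ?S = "{\<pi>. \<pi> permutes {..<n}}"
  have elem: "Poly_Mapping.lookup (tensor_prod (?ax u)) v = (if u = v then 1 else 0)" for u
  proof (cases "length u = length v \<and> u \<noteq> v")
    case True
    then obtain k where "k < length u" "u ! k \<noteq> v ! k" by (auto simp: list_eq_iff_nth_eq)
    with True show ?thesis
      by (auto simp: lookup_tensor_prod axis_def intro!: prod_zero bexI[of _ k])
  qed (auto simp: lookup_tensor_prod)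
  have "Poly_Mapping.lookup (\<Sum>w | length w = n. scale (?x w) (sym_prod (?ax w))) v =
      (\<Sum>w | length w = n. ?x w * (1 / fact n *
         (\<Sum>\<pi>\<in>?S. Poly_Mapping.lookup (tensor_prod (?ax (permute_list \<pi> w))) v)))"
    unfolding lookup_sum lookup_scale
  proof (rule sum.cong)
    fix w :: "'d list" assume "w \<in> {w. length w = n}"
    then show "?x w * Poly_Mapping.lookup (sym_prod (?ax w)) v = ?x w * (1 / fact n *
         (\<Sum>\<pi>\<in>?S. Poly_Mapping.lookup (tensor_prod (?ax (permute_list \<pi> w))) v))"
      by (auto simp: sym_prod_def lookup_sum permute_list_map intro!: sum.cong)
  qed simp
  also have "\<dots> = 1 / fact n * (\<Sum>\<pi>\<in>?S. \<Sum>w | length w = n. if permute_list \<pi> w = v then ?x w else 0)"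
    unfolding elem sum_distrib_left by (subst sum.swap) (auto intro!: sum.cong)
  also have "(\<Sum>\<pi>\<in>?S. \<Sum>w | length w = n. if permute_list \<pi> w = v then ?x w else 0) = (\<Sum>\<pi>\<in>?S. ?x v)"
  proof (rule sum.cong)
    fix \<pi> assume "\<pi> \<in> ?S"
    then have \<pi>: "\<pi> permutes {..<n}" by simp
    \<comment> \<open>The symmetry of \<open>\<xi>\<close> moves the permutation into the coordinate, after which the word can be
      renamed.\<close>
    have "(\<Sum>w | length w = n. if permute_list \<pi> w = v then ?x w else 0) =
        (\<Sum>w | length w = n. if permute_list \<pi> w = v then ?x (permute_list \<pi> w) else 0)"
      using assms \<pi> by (intro sum.cong) (auto simp: sym_tensors_def)
    also have "\<dots> = (\<Sum>w | length w = n. if w = v then ?x w else 0)"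
      by (rule sum_words_permute[OF \<pi>])
    also have "\<dots> = ?x v"
      using assms by (auto simp: sum.delta[OF finite_words] sym_tensors_def in_keys_iff)
    finally show "(\<Sum>w | length w = n. if permute_list \<pi> w = v then ?x w else 0) = ?x v" .
  qed simp
  also have "1 / fact n * (\<Sum>\<pi>\<in>?S. ?x v) = ?x v"
    by (simp add: card_permutations)
  finally show "?x v = Poly_Mapping.lookup (\<Sum>w | length w = n. scale (?x w) (sym_prod (?ax w))) v" ..
qed

lemma linear_on_sym_tensors_eqI:
  fixes f g :: "'d::finite tensor \<Rightarrow> ('b \<Rightarrow>\<^sub>0 complex)"
  assumes "linear_on (sym_tensors n) f" "linear_on (sym_tensors n) g"
    and "\<And>vs. length vs = n \<Longrightarrow> f (sym_prod vs) = g (sym_prod vs)"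
    and "\<xi> \<in> sym_tensors n"
  shows "f \<xi> = g \<xi>"
proof -
  let ?e = "\<lambda>w. sym_prod (map (\<lambda>j. axis j 1 :: complex ^ 'd) w)"
  have e: "?e w \<in> sym_tensors n" if "w \<in> {w. length w = n}" for w
    using sym_prod_in_sym_tensors[of "map (\<lambda>j. axis j 1 :: complex ^ 'd) w"] that by simp
  have "f (\<Sum>w | length w = n. scale (Poly_Mapping.lookup \<xi> w) (?e w)) =
      (\<Sum>w | length w = n. scale (Poly_Mapping.lookup \<xi> w) (f (?e w)))"
    by (rule linear_on_sum[OF assms(1) sym_tensors_subspace e])
  also have "\<dots> = (\<Sum>w | length w = n. scale (Poly_Mapping.lookup \<xi> w) (g (?e w)))"
    by (intro sum.cong) (simp_all add: assms(3))
  also have "\<dots> = g (\<Sum>w | length w = n. scale (Poly_Mapping.lookup \<xi> w) (?e w))"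
    by (rule linear_on_sum[OF assms(2) sym_tensors_subspace e, symmetric])
  finally have "f (\<Sum>w | length w = n. scale (Poly_Mapping.lookup \<xi> w) (?e w)) =
      g (\<Sum>w | length w = n. scale (Poly_Mapping.lookup \<xi> w) (?e w))" .
  then show ?thesis using sym_tensors_expansion[OF assms(4)] by simp
qed

lemma tinner_eq_sum_words:
  fixes \<xi> :: "'d::finite tensor"
  assumes "\<xi> \<in> sym_tensors n"
  shows "tinner \<xi> \<eta> = (\<Sum>w | length w = n. cnj (Poly_Mapping.lookup \<xi> w) * Poly_Mapping.lookup \<eta> w)"
  unfolding tinner_def using assms
  by (intro sum.mono_neutral_left finite_words) (auto simp: sym_tensors_def in_keys_iff)

lemma tinner_self_eq_zero:
  fixes \<xi> :: "'d::finite tensor"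
  assumes "tinner \<xi> \<xi> = 0"
  shows "\<xi> = 0"
proof -
  have "tinner \<xi> \<xi> = of_real (\<Sum>w\<in>Poly_Mapping.keys \<xi>. (cmod (Poly_Mapping.lookup \<xi> w))\<^sup>2)"
    unfolding tinner_def of_real_sum
    by (intro sum.cong) (simp_all add: complex_norm_square mult.commute del: of_real_power)
  then have "(\<Sum>w\<in>Poly_Mapping.keys \<xi>. (cmod (Poly_Mapping.lookup \<xi> w))\<^sup>2) = 0"
    using assms by (metis of_real_eq_0_iff)
  then have "Poly_Mapping.lookup \<xi> w = 0" for w
    by (subst (asm) sum_nonneg_eq_0_iff) (auto simp: in_keys_iff)
  then show ?thesis by (intro poly_mapping_eqI) simp
qed

text \<open>Conversely, every function of the multiset of letters defines a symmetric tensor. This is how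
  preimages under \<open>U\<close> and values of \<open>\<Omega>\<close> are produced.\<close>

definition words_tensor :: "nat \<Rightarrow> ('d::finite multiset \<Rightarrow> complex) \<Rightarrow> 'd tensor" where
  "words_tensor n f = (\<Sum>w | length w = n. Poly_Mapping.single w (f (mset w)))"

lemma lookup_words_tensor:
  "Poly_Mapping.lookup (words_tensor n f) w = (if length w = n then f (mset w) else 0)"
  by (simp add: words_tensor_def lookup_sum lookup_single when_def sum.delta[OF finite_words])

lemma words_tensor_in_sym_tensors: "words_tensor n f \<in> sym_tensors n"
  by (auto simp: sym_tensors_def lookup_words_tensor in_keys_iff split: if_splits)


section \<open>The Jacobi sequences\<close>

context product_favard
begin

text \<open>The explicit form of \<open>U\<close>: the elementary tensor of the basis vectors spelled by a word \<open>w\<close>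
  goes to \<open>Q (mset w)\<close>. It is defined on all tensors, and \<open>U\<close> is its restriction to the symmetric
  ones.\<close>

definition tensor_to_poly :: "nat \<Rightarrow> 'd tensor \<Rightarrow> 'd mpoly" where
  "tensor_to_poly n \<xi> = (\<Sum>w | length w = n. scale (Poly_Mapping.lookup \<xi> w) (Q (mset w)))"

lemma tensor_to_poly_add: "tensor_to_poly n (\<xi> + \<eta>) = tensor_to_poly n \<xi> + tensor_to_poly n \<eta>"
  by (simp add: tensor_to_poly_def lookup_add free_vs.scale_left_distrib sum.distrib)

lemma tensor_to_poly_scale: "tensor_to_poly n (scale c \<xi>) = scale c (tensor_to_poly n \<xi>)"
  by (simp add: tensor_to_poly_def free_vs.scale_sum_right)

lemma tensor_to_poly_sum: "tensor_to_poly n (\<Sum>a\<in>A. f a) = (\<Sum>a\<in>A. tensor_to_poly n (f a))"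
proof (induction A rule: infinite_finite_induct)
  case (insert a A)
  then show ?case by (simp add: tensor_to_poly_add)
qed (simp_all add: tensor_to_poly_def)

text \<open>Reordering the factors of an elementary tensor does not change its image, because \<open>Q\<close> is
  evaluated at the multiset of the letters of a word. All terms of the symmetrization therefore
  have the same image, which is the product of creation operators.\<close>

lemma tensor_to_poly_sym_prod:
  assumes "length vs = n"
  shows "tensor_to_poly n (sym_prod vs) = foldr (creation_vec \<nu>) vs 1"
proof -
  have elem: "tensor_to_poly n (tensor_prod vs) = foldr (creation_vec \<nu>) vs 1"
    using assms by (simp add: tensor_to_poly_def foldr_creation_vec lookup_tensor_prod)
  have "tensor_to_poly n (tensor_prod (permute_list \<pi> vs)) = tensor_to_poly n (tensor_prod vs)"
    if \<pi>: "\<pi> permutes {..<n}" for \<pi>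
  proof -
    have "tensor_to_poly n (tensor_prod (permute_list \<pi> vs)) =
        (\<Sum>w | length w = n. scale (Poly_Mapping.lookup (tensor_prod (permute_list \<pi> vs))
           (permute_list \<pi> w)) (Q (mset (permute_list \<pi> w))))"
      unfolding tensor_to_poly_def by (rule sum_words_permute[OF \<pi>, symmetric])
    also have "\<dots> = tensor_to_poly n (tensor_prod vs)"
      unfolding tensor_to_poly_def using \<pi> assms
      by (intro sum.cong) (auto simp: lookup_tensor_prod_permute)
    finally show ?thesis .
  qed
  then have "(\<Sum>\<pi> | \<pi> permutes {..<n}. tensor_to_poly n (tensor_prod (permute_list \<pi> vs))) =
      (\<Sum>\<pi> | \<pi> permutes {..<n}. foldr (creation_vec \<nu>) vs 1)"
    by (intro sum.cong) (simp_all add: elem)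
  also have "\<dots> = scale (fact n) (foldr (creation_vec \<nu>) vs 1)"
    unfolding sum_constant_scale by (simp add: card_permutations)
  finally show ?thesis
    using assms by (simp add: sym_prod_def tensor_to_poly_scale tensor_to_poly_sum)
qed

text \<open>The sum of the coordinates over one class of words is a Fourier coefficient. This gives both
  the injectivity of \<open>U\<close> and the formula for \<open>\<Omega>\<close>.\<close>

lemma pinner_Q_tensor_to_poly:
  "pinner \<nu> (Q M) (tensor_to_poly n \<xi>) =
     of_real (Q_norm2 M) * (\<Sum>w | length w = n \<and> mset w = M. Poly_Mapping.lookup \<xi> w)"
proof -
  have "pinner \<nu> (Q M) (tensor_to_poly n \<xi>) =
      (\<Sum>w | length w = n. if mset w = M then of_real (Q_norm2 M) * Poly_Mapping.lookup \<xi> w else 0)"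
    unfolding tensor_to_poly_def
    by (auto simp: pinner_sum_right pinner_scale_right pinner_Q intro!: sum.cong)
  also have "\<dots> = (\<Sum>w\<in>{w. length w = n} \<inter> {w. mset w = M}. of_real (Q_norm2 M) * Poly_Mapping.lookup \<xi> w)"
    by (subst sum.inter_restrict) (auto simp: finite_words intro!: sum.cong)
  finally show ?thesis
    by (simp add: sum_distrib_left Collect_conj_eq)
qed

text \<open>The coordinates of a symmetric tensor are constant on each class of words, so a vanishing sum
  over a class forces all of them to vanish.\<close>

lemma tensor_to_poly_eq_zero:
  assumes "\<xi> \<in> sym_tensors n" "tensor_to_poly n \<xi> = 0"
  shows "\<xi> = 0"
proof (rule poly_mapping_eqI)
  fix w :: "'d list"
  show "Poly_Mapping.lookup \<xi> w = Poly_Mapping.lookup 0 w"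
  proof (cases "length w = n")
    case True
    let ?C = "{v. length v = n \<and> mset v = mset w}"
    have "finite ?C" by (rule finite_subset[OF _ finite_words[of n]]) auto
    moreover have "w \<in> ?C" using True by simp
    ultimately have card: "card ?C \<noteq> 0" by auto
    have "(\<Sum>v\<in>?C. Poly_Mapping.lookup \<xi> v) = (\<Sum>v\<in>?C. Poly_Mapping.lookup \<xi> w)"
      by (intro sum.cong) (auto intro: lookup_sym_tensor_mset_eq[OF assms(1)])
    moreover have "of_real (Q_norm2 (mset w)) * (\<Sum>v\<in>?C. Poly_Mapping.lookup \<xi> v) = 0"
      using pinner_Q_tensor_to_poly[of "mset w" n \<xi>] assms(2) by simp
    ultimately show ?thesis
      using card Q_norm2_pos[of "mset w"] by (simp del: card_eq_0_iff)
  qed (use assms(1) in \<open>simp add: sym_tensors_iff\<close>)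
qed

text \<open>Surjectivity: the coefficient of \<open>Q M\<close> is spread evenly over the words with letters
  \<open>M\<close>.\<close>

lemma tensor_to_poly_words_tensor:
  "tensor_to_poly n (words_tensor n (\<lambda>M. c M / of_nat (card {w. length w = n \<and> mset w = M}))) =
     (\<Sum>M | size M = n. scale (c M) (Q M))"
proof -
  let ?C = "\<lambda>M. {w. length w = n \<and> mset w = M}"
  let ?d = "\<lambda>M. c M / of_nat (card (?C M))"
  have "tensor_to_poly n (words_tensor n ?d) = (\<Sum>w | length w = n. scale (?d (mset w)) (Q (mset w)))"
    unfolding tensor_to_poly_def by (intro sum.cong) (auto simp: lookup_words_tensor)
  also have "\<dots> = (\<Sum>M | size M = n. \<Sum>w\<in>{w\<in>{w. length w = n}. mset w = M}. scale (?d (mset w)) (Q (mset w)))"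
    by (rule sum.group[symmetric]) (auto simp: finite_words finite_size_eq)
  also have "\<dots> = (\<Sum>M | size M = n. scale (c M) (Q M))"
  proof (rule sum.cong)
    fix M :: "'d multiset" assume "M \<in> {M. size M = n}"
    moreover obtain w where "mset w = M" using ex_mset by blast
    ultimately have "w \<in> ?C M" by auto
    moreover have "finite (?C M)" by (rule finite_subset[OF _ finite_words[of n]]) auto
    ultimately have card: "card (?C M) \<noteq> 0" by auto
    have "(\<Sum>w\<in>{w\<in>{w. length w = n}. mset w = M}. scale (?d (mset w)) (Q (mset w))) =
        (\<Sum>w\<in>?C M. scale (?d M) (Q M))"
      by (intro sum.cong) auto
    also have "\<dots> = scale (c M) (Q M)"
      unfolding sum_constant_scale using card by (simp del: card_eq_0_iff)
    finally show "(\<Sum>w\<in>{w\<in>{w. length w = n}. mset w = M}. scale (?d (mset w)) (Q (mset w))) =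
        scale (c M) (Q M)" .
  qed simp
  finally show ?thesis .
qed

lemma bij_betw_tensor_to_poly: "bij_betw (tensor_to_poly n) (sym_tensors n) (graded_part \<nu> n)"
proof (rule bij_betw_imageI)
  show "inj_on (tensor_to_poly n) (sym_tensors n)"
  proof (rule inj_onI)
    fix \<xi> \<eta> assume h: "\<xi> \<in> sym_tensors n" "\<eta> \<in> sym_tensors n" "tensor_to_poly n \<xi> = tensor_to_poly n \<eta>"
    have "tensor_to_poly n (\<xi> - \<eta>) = 0"
      using h(3) tensor_to_poly_add[of n "\<xi> - \<eta>" \<eta>] by simp
    moreover have "\<xi> - \<eta> \<in> sym_tensors n"
      using h by (intro free_vs.subspace_diff sym_tensors_subspace)
    ultimately have "\<xi> - \<eta> = 0" by (intro tensor_to_poly_eq_zero)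
    then show "\<xi> = \<eta>" by simp
  qed
  show "tensor_to_poly n ` sym_tensors n = graded_part \<nu> n"
  proof (intro subset_antisym subsetI)
    fix p assume "p \<in> tensor_to_poly n ` sym_tensors n"
    then show "p \<in> graded_part \<nu> n"
      unfolding tensor_to_poly_def by (auto intro!: sum_Q_in_graded_part)
  next
    fix p assume "p \<in> graded_part \<nu> n"
    then obtain c where "p = (\<Sum>M | size M = n. scale (c M) (Q M))"
      using span_Q_expansion[OF finite_size_eq] by (auto simp: graded_part_eq_span_Q)
    then have "p = tensor_to_poly n
        (words_tensor n (\<lambda>M. c M / of_nat (card {w. length w = n \<and> mset w = M})))"
      by (simp only: tensor_to_poly_words_tensor)
    then show "p \<in> tensor_to_poly n ` sym_tensors n"
      by (rule image_eqI) (rule words_tensor_in_sym_tensors)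
  qed
qed

text \<open>The explicit map has the properties that describe \<open>U\<close>, and these determine it, because
  symmetric products span.\<close>

lemma U_map_eq: "U_map \<nu> n = restrict (tensor_to_poly n) (sym_tensors n)"
  unfolding U_map_def
proof (rule the_equality)
  have lin: "linear_on (sym_tensors n) (restrict (tensor_to_poly n) (sym_tensors n))"
    by (simp add: linear_on_def tensor_to_poly_add tensor_to_poly_scale
        free_vs.subspace_add[OF sym_tensors_subspace] free_vs.subspace_scale[OF sym_tensors_subspace])
  have sym: "restrict (tensor_to_poly n) (sym_tensors n) (sym_prod vs) = foldr (creation_vec \<nu>) vs 1"
    if "length vs = n" for vs
    using that tensor_to_poly_sym_prod[OF that] sym_prod_in_sym_tensors[of vs] by simp
  show "restrict (tensor_to_poly n) (sym_tensors n) \<in> extensional (sym_tensors n) \<and>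
      linear_on (sym_tensors n) (restrict (tensor_to_poly n) (sym_tensors n)) \<and>
      bij_betw (restrict (tensor_to_poly n) (sym_tensors n)) (sym_tensors n) (graded_part \<nu> n) \<and>
      (\<forall>vs. length vs = n \<longrightarrow>
         restrict (tensor_to_poly n) (sym_tensors n) (sym_prod vs) = foldr (creation_vec \<nu>) vs 1)"
    using lin sym bij_betw_tensor_to_poly[of n] by (simp add: bij_betw_restrict_eq)
  fix U assume U: "U \<in> extensional (sym_tensors n) \<and> linear_on (sym_tensors n) U \<and>
      bij_betw U (sym_tensors n) (graded_part \<nu> n) \<and>
      (\<forall>vs. length vs = n \<longrightarrow> U (sym_prod vs) = foldr (creation_vec \<nu>) vs 1)"
  show "U = restrict (tensor_to_poly n) (sym_tensors n)"
  proof (rule extensionalityI)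
    have "linear_on (sym_tensors n) U" using U by blast
    moreover have "U (sym_prod vs) = restrict (tensor_to_poly n) (sym_tensors n) (sym_prod vs)"
      if "length vs = n" for vs
      using U sym[OF that] that by presburger
    moreover fix \<xi> :: "'d tensor" assume "\<xi> \<in> sym_tensors n"
    ultimately show "U \<xi> = restrict (tensor_to_poly n) (sym_tensors n) \<xi>"
      using linear_on_sym_tensors_eqI[of n U "restrict (tensor_to_poly n) (sym_tensors n)" \<xi>] lin by metis
  qed (use U in auto)
qed

lemma bij_betw_U_map: "bij_betw (U_map \<nu> n) (sym_tensors n) (graded_part \<nu> n)"
  unfolding U_map_eq using bij_betw_tensor_to_poly[of n] by (simp add: bij_betw_restrict_eq)

lemma U_map_scale: "\<xi> \<in> sym_tensors n \<Longrightarrow> U_map \<nu> n (scale c \<xi>) = scale c (U_map \<nu> n \<xi>)"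
  using free_vs.subspace_scale[OF sym_tensors_subspace, of \<xi> n c]
  by (simp add: U_map_eq tensor_to_poly_scale)

lemma e_basis_in_sym_tensors: "e_basis (cl w) \<in> sym_tensors (length w)"
  unfolding e_basis_cl using sym_prod_in_sym_tensors[of "map (\<lambda>j. axis j 1) w"] by simp

text \<open>In the expansion of a product of creation operators of basis vectors, all words but \<open>w\<close>
  have coefficient zero.\<close>

lemma U_map_e_basis: "U_map \<nu> (length w) (e_basis (cl w)) = Q (mset w)"
proof -
  let ?ax = "map (\<lambda>j. axis j 1 :: complex ^ 'd) w"
  have coeff: "(\<Prod>k<length ?ax. (?ax ! k) $ (v ! k)) = (if v = w then 1 else 0)"
    if len: "length v = length ?ax" for v
  proof (cases "v = w")
    case False
    then obtain k where "k < length w" "v ! k \<noteq> w ! k" using len by (auto simp: list_eq_iff_nth_eq)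
    then show ?thesis using False by (auto simp: axis_def intro!: prod_zero bexI[of _ k])
  qed simp
  have "U_map \<nu> (length w) (e_basis (cl w)) = foldr (creation_vec \<nu>) ?ax 1"
    using e_basis_in_sym_tensors[of w] tensor_to_poly_sym_prod[of ?ax "length w"]
    by (simp add: U_map_eq e_basis_cl)
  also have "\<dots> = (\<Sum>v | length v = length ?ax. scale (if v = w then 1 else 0) (Q (mset v)))"
    unfolding foldr_creation_vec by (intro sum.cong) (use coeff in auto)
  also have "\<dots> = (\<Sum>v\<in>{w}. Q (mset v))"
    by (rule sum.mono_neutral_cong_right) (auto simp: finite_words)
  finally show ?thesis by simp
qed

text \<open>What has to be shown is that the description of \<open>\<Omega>\<close> has exactly one solution. Expanding
  \<open>U \<xi>\<close> over words and inserting the Fourier coefficients of \<open>U \<eta>\<close> shows that the coordinate of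
  \<open>\<Omega> \<eta>\<close> at a word must be the squared norm of the corresponding \<open>Q M\<close> times the sum of the
  coordinates of \<open>\<eta>\<close> over the class of that word. Uniqueness follows by pairing the difference of
  two solutions with itself.\<close>

lemma tinner_Omega:
  assumes "\<xi> \<in> sym_tensors n" "\<eta> \<in> sym_tensors n"
  shows "tinner \<xi> (Omega \<nu> n \<eta>) = pinner \<nu> (U_map \<nu> n \<xi>) (U_map \<nu> n \<eta>)"
proof -
  let ?P = "\<lambda>\<Omega>. \<Omega> \<in> sym_tensors n \<rightarrow>\<^sub>E sym_tensors n \<and> linear_on (sym_tensors n) \<Omega> \<and>
    (\<forall>\<xi>\<in>sym_tensors n. \<forall>\<eta>\<in>sym_tensors n.
       tinner \<xi> (\<Omega> \<eta>) = pinner \<nu> (U_map \<nu> n \<xi>) (U_map \<nu> n \<eta>))"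
  define T :: "'d tensor \<Rightarrow> 'd tensor" where "T \<equiv> restrict (\<lambda>\<eta>. words_tensor n
    (\<lambda>M. of_real (Q_norm2 M) * (\<Sum>v | length v = n \<and> mset v = M. Poly_Mapping.lookup \<eta> v))) (sym_tensors n)"
  have "?P T"
  proof (intro conjI ballI)
    show "T \<in> sym_tensors n \<rightarrow>\<^sub>E sym_tensors n"
      unfolding T_def using words_tensor_in_sym_tensors by (auto simp: PiE_iff)
    show "linear_on (sym_tensors n) T"
      by (auto simp: linear_on_def T_def lookup_words_tensor lookup_add sum.distrib distrib_left
          sum_distrib_left mult.left_commute intro!: poly_mapping_eqI
          simp: free_vs.subspace_add[OF sym_tensors_subspace] free_vs.subspace_scale[OF sym_tensors_subspace])
    fix \<xi> \<eta> :: "'d tensor" assume h: "\<xi> \<in> sym_tensors n" "\<eta> \<in> sym_tensors n"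
    have "tinner \<xi> (T \<eta>) = (\<Sum>w | length w = n. cnj (Poly_Mapping.lookup \<xi> w) *
        pinner \<nu> (Q (mset w)) (tensor_to_poly n \<eta>))"
      unfolding tinner_eq_sum_words[OF h(1)] using h(2)
      by (intro sum.cong) (auto simp: T_def lookup_words_tensor pinner_Q_tensor_to_poly)
    also have "\<dots> = pinner \<nu> (tensor_to_poly n \<xi>) (tensor_to_poly n \<eta>)"
      by (simp add: tensor_to_poly_def[of n \<xi>] pinner_sum_left pinner_scale_left)
    finally show "tinner \<xi> (T \<eta>) = pinner \<nu> (U_map \<nu> n \<xi>) (U_map \<nu> n \<eta>)"
      using h by (simp add: U_map_eq)
  qed
  moreover have "T' = T" if T': "?P T'" for T'
  proof (rule extensionalityI)
    fix \<eta> :: "'d tensor" assume \<eta>: "\<eta> \<in> sym_tensors n"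
    have mem: "T' \<eta> \<in> sym_tensors n" "T \<eta> \<in> sym_tensors n"
      using T' \<open>?P T\<close> \<eta> unfolding PiE_iff by blast+
    then have D: "T' \<eta> - T \<eta> \<in> sym_tensors n"
      by (intro free_vs.subspace_diff sym_tensors_subspace)
    have "tinner (T' \<eta> - T \<eta>) (T' \<eta>) = tinner (T' \<eta> - T \<eta>) (T \<eta>)"
      using T' \<open>?P T\<close> \<eta> D by metis
    then have "tinner (T' \<eta> - T \<eta>) (T' \<eta> - T \<eta>) = 0"
      unfolding tinner_eq_sum_words[OF D] by (simp add: lookup_minus right_diff_distrib sum_subtractf)
    then show "T' \<eta> = T \<eta>" using tinner_self_eq_zero by fastforce
  next
    show "T' \<in> extensional (sym_tensors n)" "T \<in> extensional (sym_tensors n)"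
      using T' \<open>?P T\<close> unfolding PiE_iff by blast+
  qed
  ultimately have "\<exists>!\<Omega>. ?P \<Omega>" by (rule ex1I)
  then have "?P (Omega \<nu> n)"
    unfolding Omega_def by (rule theI')
  then have "\<forall>\<xi>\<in>sym_tensors n. \<forall>\<eta>\<in>sym_tensors n.
      tinner \<xi> (Omega \<nu> n \<eta>) = pinner \<nu> (U_map \<nu> n \<xi>) (U_map \<nu> n \<eta>)"
    by (elim conjE)
  from this[rule_format, OF assms] show ?thesis .
qed

end

theorem theorem5:
  fixes \<mu> :: "'d::finite \<Rightarrow> real measure"
    and \<alpha> \<beta> :: "'d \<Rightarrow> nat \<Rightarrow> real"
    and P :: "'d \<Rightarrow> nat \<Rightarrow> complex poly"
    and n :: nat
    and m :: "'d \<Rightarrow> nat"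
    and i j :: "'d list"
  assumes "\<And>k. prob_space (\<mu> k)"
    and "\<And>k. sets (\<mu> k) = sets borel"
    and "\<And>k r. integrable (\<mu> k) (\<lambda>x. x ^ r)"
    and "\<And>k. favard_sequences (\<mu> k) (\<alpha> k) (\<beta> k) (P k)"
    and "n \<ge> 1"
    and "length i = n"
    and "length j = n"
    and "\<And>l. m l = card {k. k < n \<and> i ! k = l}"
  shows "Omega_entry (Pi\<^sub>M UNIV \<mu>) n (cl i) (cl j) =
           (if cl i = cl j then of_real (\<Prod>r\<in>UNIV. (\<Prod>k<m r. \<beta> r k)\<^sup>2) else 0) \<and>
         (\<forall>l. alpha_op (Pi\<^sub>M UNIV \<mu>) l n (e_basis (cl i)) =
                scale (of_real (\<alpha> l (m l))) (e_basis (cl i)))"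
proof -
  interpret product_favard \<mu> \<alpha> \<beta> P
    by (rule product_favard.intro) (fact assms)+
  have m: "m l = count (mset i) l" for l
  proof -
    have "{k. k < n \<and> i ! k = l} = {k. k < length i \<and> l = i ! k}" using assms(6) by auto
    then show ?thesis
      using assms(8) by (simp add: count_mset count_list_eq_length_filter length_filter_conv_card)
  qed
  have mem: "e_basis (cl i) \<in> sym_tensors n" "e_basis (cl j) \<in> sym_tensors n"
    using assms(6,7) e_basis_in_sym_tensors[of i] e_basis_in_sym_tensors[of j] by auto
  have U: "U_map \<nu> n (e_basis (cl i)) = Q (mset i)" "U_map \<nu> n (e_basis (cl j)) = Q (mset j)"
    using assms(6,7) U_map_e_basis[of i] U_map_e_basis[of j] by auto
  have "Omega_entry \<nu> n (cl i) (cl j) = pinner \<nu> (Q (mset i)) (Q (mset j))"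
    using tinner_Omega[OF mem] by (simp add: Omega_entry_def U)
  also have "\<dots> = (if cl i = cl j then of_real (\<Prod>r\<in>UNIV. (\<Prod>k<m r. \<beta> r k)\<^sup>2) else 0)"
    by (simp add: pinner_Q cl_eq_iff Q_norm2_def m)
  finally have Omega: "Omega_entry \<nu> n (cl i) (cl j) =
      (if cl i = cl j then of_real (\<Prod>r\<in>UNIV. (\<Prod>k<m r. \<beta> r k)\<^sup>2) else 0)" .
  have "alpha_op \<nu> l n (e_basis (cl i)) = scale (of_real (\<alpha> l (m l))) (e_basis (cl i))" for l
  proof -
    have "preservation_at \<nu> n l (U_map \<nu> n (e_basis (cl i))) =
        U_map \<nu> n (scale (of_real (\<alpha> l (m l))) (e_basis (cl i)))"
      using preservation_Q[of "mset i" l] assms(6) by (simp add: U U_map_scale[OF mem(1)] m)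
    then show ?thesis
      unfolding alpha_op_def using bij_betw_U_map[of n] mem(1)
      by (simp add: bij_betw_def inv_into_f_f free_vs.subspace_scale[OF sym_tensors_subspace])
  qed
  with Omega show ?thesis by simp
qed

end
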